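(* Let $\hat x\in\mathbb{R}^n$, let $\boldsymbol{\xi}$ be an $m$-dimensional random vector and let $g:\mathbb{R}^m\times\mathbb{R}^n\to\mathbb{R}$ be a function such that $g(\boldsymbol{\xi},x)$ is an integrable random variable for every $x\in\mathbb{R}^n$. Suppose that there is a neighborhood $X$ of $\hat x$ such that the following hold: (a) For each $x\in X$, there is a set $\Xi\subset\mathbb{R}^m$, with $\mathrm{prob}\{\boldsymbol{\xi}\in\Xi\}=1$, such that $g(\xi,\cdot\,)$ is smooth at $x$ for every $\xi\in\Xi$. (b) There are $\varepsilon>0$ and $\delta\in(0,1]$ such that $\mathrm{prob}\{g(\boldsymbol{\xi},x)\ge\varepsilon\}\ge\delta$ for all $x\in X$. (c) There is a measurable function $h:\mathbb{R}^m\to[0,\infty)$ such that $\mathbb{E}[h(\boldsymbol{\xi})]<\infty$ and $|g(\xi,x)|\le h(\xi)$ for all $\xi\in\mathbb{R}^m$ and $x\in X$. (d) There is a measurable function $\kappa:\mathbb{R}^m\to[0,\infty)$ such that $\mathbb{E}[\kappa(\boldsymbol{\xi})]<\infty$ and $$|g(\xi,x)-g(\xi,x')|\le\kappa(\xi)\|x-x'\|_2\quad\text{for all } x,x'\in X,\ \xi\in\mathbb{R}^m.$$ (e) If $\gamma>0$ and $x\in X$, then $\mathrm{prob}\{-\gamma g(\boldsymbol{\xi},x)=1\}=0$. (f) The set of minimizers $\Gamma(\hat x)=\operatorname{argmin}_{\gamma\ge 0}\mathbb{E}\big[\max\{0,\gamma g(\boldsymbol{\xi},\hat x)+1\}\big]$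 is the single point $\hat\gamma$. Then the buffered failure probability $\bar p$ is differentiable at $\hat x$ and $$\nabla\bar p(\hat x)=\mathbb{E}\big[F(\boldsymbol{\xi},\hat x,\hat\gamma)\big],\quad\text{where } F(\xi,\hat x,\hat\gamma)=\begin{cases}0 & \text{if }\hat\gamma g(\xi,\hat x)+1\le 0\\ \hat\gamma\nabla_x g(\xi,\hat x) & \text{otherwise.}\end{cases}$$
   Context: Smoothness. "$g(\xi,\cdot\,)$ is smooth at $x$" means that it is continuously differentiable in a neighborhood of $x$ (the neighborhood may depend on $\xi$). By (a), $F(\xi,\hat x,\hat\gamma)$ is defined for all $\xi$ in a set of probability one, which suffices for the expectation. Buffered failure probability. For $x\in\mathbb{R}^n$, let $p(x)=\mathrm{prob}\{g(\boldsymbol{\xi},x)>0\}$ be the (conventional) failure probability. The buffered failure probability is $$\bar p(x)=\begin{cases}0 & \text{if } p(x)=0\\ 1-\bar\alpha & \text{if } p(x)>0 \text{ and } \mathbb{E}[g(\boldsymbol{\xi},x)]<0\\ 1 & \text{otherwise,}\end{cases}$$ where $\bar\alpha\in[0,1]$ (depending on $x$) is the probability level $\alpha$ that makes the $\alpha$-superquantile $\bar q_\alpha(x)$ of $g(\boldsymbol{\xi},x)$ equal to zero. The superquantile is $$\bar q_\alpha(x)=q_\alpha(x)+\frac{1}{1-\alpha}\mathbb{E}\big[\max\{0,g(\boldsymbol{\xi},x)-q_\alpha(x)\}\big]\quad\text{for }\alpha\in(0,1),$$ where $q_\alpha(x)=\min\{z\in\mathbb{R} : \mathrm{prob}\{g(\boldsymbol{\xi},x)\le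 z\}\ge\alpha\}$ is the $\alpha$-quantile of $g(\boldsymbol{\xi},x)$, with $\bar q_0(x)=\mathbb{E}[g(\boldsymbol{\xi},x)]$ and $\bar q_1(x)=\lim_{\alpha\nearrow 1}\bar q_\alpha(x)$. Known formula (Norton and Uryasev; Mafusalov and Uryasev): whenever $p(x)>0$, one has $\bar p(x)=\min_{\gamma\ge 0}\mathbb{E}\big[\max\{0,\gamma g(\boldsymbol{\xi},x)+1\}\big]$. *)

theory Defs
  imports "HOL-Probability.Probability"
begin

definition smooth_at :: "('a::euclidean_space \<Rightarrow> real) \<Rightarrow> 'a \<Rightarrow> bool" where
  "smooth_at f x \<longleftrightarrow>
     (\<exists>U G. open U \<and> x \<in> U \<and> (\<forall>y\<in>U. GDERIV f y :> G y) \<and> continuous_on U G)"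

(* Where f is not differentiable at x, the value is a fixed vector that does not depend
   on f or x. *)
definition gradient :: "('a::euclidean_space \<Rightarrow> real) \<Rightarrow> 'a \<Rightarrow> 'a" where
  "gradient f x = (THE D. GDERIV f x :> D)"

definition quantile :: "'w measure \<Rightarrow> ('w \<Rightarrow> real) \<Rightarrow> real \<Rightarrow> real" where
  "quantile M Y \<alpha> = (LEAST z. measure M {\<omega> \<in> space M. Y \<omega> \<le> z} \<ge> \<alpha>)"

definition superquantile_interior :: "'w measure \<Rightarrow> ('w \<Rightarrow> real) \<Rightarrow> real \<Rightarrow> real" where
  "superquantile_interior M Y \<alpha> =
     quantile M Y \<alpha>
     + 1 / (1 - \<alpha>) * integral\<^sup>L M (\<lambda>\<omega>. max 0 (Y \<omega> - quantile M Y \<alpha>))"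

(* Intended for levels in [0,1]. The value is an extended real because the limit defining
   the superquantile at level 1 is infinite when Y is not essentially bounded above. *)
definition superquantile :: "'w measure \<Rightarrow> ('w \<Rightarrow> real) \<Rightarrow> real \<Rightarrow> ereal" where
  "superquantile M Y \<alpha> =
     (if \<alpha> = 0 then ereal (integral\<^sup>L M Y)
      else if \<alpha> = 1 then Lim (at_left 1) (\<lambda>\<beta>. ereal (superquantile_interior M Y \<beta>))
      else ereal (superquantile_interior M Y \<alpha>))"

definition failure_prob ::
    "'w measure \<Rightarrow> ('w \<Rightarrow> 'm) \<Rightarrow> ('m \<Rightarrow> 'n \<Rightarrow> real) \<Rightarrow> 'n \<Rightarrow> real" where
  "failure_prob M \<xi> g x = measure M {\<omega> \<in> space M. g (\<xi> \<omega>) x > 0}"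

(* In the middle case an integrable g(\<xi>,x) has a negative superquantile at level 0 and a
   positive one at level 1, and the superquantile is continuous and strictly increasing
   in between until it reaches the essential supremum; so exactly one level qualifies. *)
definition buffered_failure_prob ::
    "'w measure \<Rightarrow> ('w \<Rightarrow> 'm) \<Rightarrow> ('m \<Rightarrow> 'n \<Rightarrow> real) \<Rightarrow> 'n \<Rightarrow> real" where
  "buffered_failure_prob M \<xi> g x =
     (if failure_prob M \<xi> g x = 0 then 0
      else if integral\<^sup>L M (\<lambda>\<omega>. g (\<xi> \<omega>) x) < 0
        then 1 - (THE \<alpha>. \<alpha> \<in> {0..1} \<and> superquantile M (\<lambda>\<omega>. g (\<xi> \<omega>) x) \<alpha> = 0)
      else 1)"

definition grad_integrand ::
    "('m \<Rightarrow> 'n \<Rightarrow> real) \<Rightarrow> 'm \<Rightarrow> 'n \<Rightarrow> real \<Rightarrow> 'n::euclidean_space" where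
  "grad_integrand g z x \<gamma> = (if \<gamma> * g z x + 1 \<le> 0 then 0 else \<gamma> *\<^sub>R gradient (g z) x)"

end

theory Submission
  imports Defs
begin

text \<open>The buffered failure probability is an optimal value.  Write
\<open>\<phi>(x, \<gamma>) = E[max(0, \<gamma> g(\<xi>, x) + 1)]\<close>.  Near \<open>xhat\<close> the buffered failure probability
is the minimum of \<open>\<phi>(x, \<cdot>)\<close> over \<open>\<gamma> \<ge> 0\<close>, and the theorem is an envelope
(Danskin-type) result for this minimum.

The minimum formula, \<open>buffered_failure_prob_eq_min_hinge_mean\<close>, rests on one
observation about \<open>Y = g(\<xi>, x)\<close>, which has no atom on the negative half-line.
A threshold \<open>t < 0\<close> with \<open>E[Y; Y > t] = 0\<close> does two jobs.  On the one hand
\<open>\<gamma> = -1/t\<close> minimizes the hinge mean, because for every \<open>\<gamma>' \<ge> 0\<close>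
\<open>E[max(0, \<gamma>' Y + 1)] \<ge> E[\<gamma>' Y + 1; Y > t] = P(Y > t)\<close>, with equality at \<open>-1/t\<close>.
On the other hand the superquantile of level \<open>\<alpha> = P(Y \<le> t)\<close> vanishes.  So
\<open>1 - \<alpha> = P(Y > t)\<close> is the minimum.  Suppose \<open>E[Y] < 0\<close>.  If the superquantile vanishes at
a level strictly between 0 and 1, the quantile of that level is such a threshold, so all these
levels coincide; the levels 0 and 1 do not compete, since the superquantile is negative at 0
and positive at 1.  Conversely, the first-order condition at a minimizer produces such a
threshold, so a zero level exists.  If \<open>E[Y] \<ge> 0\<close>, both quantities equal 1.

For the derivative, let \<open>\<Gamma>(x)\<close> be a minimizer at \<open>x\<close>.  Comparing minimizers,
\<open>\<phi>(x, \<Gamma>(x)) - \<phi>(xhat, \<Gamma>(x)) \<le> p(x) - p(xhat) \<le> \<phi>(x, \<gamma>hat) - \<phi>(xhat, \<gamma>hat)\<close>.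
The minimizers stay in a compact interval, since \<open>P(g(\<xi>, x) \<ge> \<epsilon>) \<ge> \<delta>\<close> makes the hinge
mean grow at least like \<open>\<epsilon> \<delta> \<gamma>\<close>, so the uniqueness of \<open>\<gamma>hat\<close> forces
\<open>\<Gamma>(x) \<longlongrightarrow> \<gamma>hat\<close>.  Dominated convergence, with a multiplier that is allowed to
move with \<open>x\<close> (\<open>hinge_mean_difference_quotient\<close>), shows that both outer terms have the
linear part \<open>(x - xhat) \<bullet> E[F]\<close>, which squeezes \<open>p\<close> in between.\<close>

section \<open>Hinge means and tail means\<close>

definition hinge_mean :: "'w measure \<Rightarrow> ('w \<Rightarrow> real) \<Rightarrow> real \<Rightarrow> real" where
  "hinge_mean M Y \<gamma> = (\<integral>\<omega>. max 0 (\<gamma> * Y \<omega> + 1) \<partial>M)"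

definition tail_mean :: "'w measure \<Rightarrow> ('w \<Rightarrow> real) \<Rightarrow> real \<Rightarrow> real" where
  "tail_mean M Y t = (\<integral>\<omega>. indicat_real {t<..} (Y \<omega>) * Y \<omega> \<partial>M)"

lemma abs_max_0_diff_le: "\<bar>max 0 a - max 0 b\<bar> \<le> \<bar>a - b\<bar>" for a b :: real
  by linarith

context prob_space
begin

lemma prob_le_eq_compl:
  assumes [measurable]: "Y \<in> borel_measurable M"
  shows "prob {\<omega> \<in> space M. Y \<omega> \<le> z} = 1 - prob {\<omega> \<in> space M. (z::real) < Y \<omega>}"
proof -
  have "{\<omega> \<in> space M. Y \<omega> \<le> z} = space M - {\<omega> \<in> space M. z < Y \<omega>}" by auto
  then show ?thesis by (simp add: prob_compl)
qed

lemma integrable_tail [intro]: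
  assumes "integrable M Y"
  shows "integrable M (\<lambda>\<omega>. indicat_real {t<..} (Y \<omega>) * (Y \<omega> :: real))"
proof -
  have [measurable]: "Y \<in> borel_measurable M" using assms by auto
  show ?thesis
    by (rule Bochner_Integration.integrable_bound[OF assms]) (auto simp: indicator_def)
qed

lemma integrable_exceed [intro]:
  assumes [measurable]: "Y \<in> borel_measurable M"
  shows "integrable M (\<lambda>\<omega>. indicat_real {t<..} (Y \<omega> :: real))"
  by (rule integrable_const_bound[of _ 1]) (auto simp: indicator_def)

lemma integral_exceed:
  assumes [measurable]: "Y \<in> borel_measurable M"
  shows "(\<integral>\<omega>. indicat_real {t<..} (Y \<omega> :: real) \<partial>M) = prob {\<omega> \<in> space M. t < Y \<omega>}"
proof -
  have "(\<integral>\<omega>. indicat_real {t<..} (Y \<omega>) \<partial>M)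
     = (\<integral>\<omega>. indicat_real {\<omega> \<in> space M. t < Y \<omega>} \<omega> \<partial>M)"
    by (rule Bochner_Integration.integral_cong) (auto simp: indicator_def)
  then show ?thesis by simp
qed

lemma integral_affine_tail:
  assumes "integrable M Y"
  shows "(\<integral>\<omega>. indicat_real {t<..} (Y \<omega>) * (a * Y \<omega> + b) \<partial>M)
      = a * tail_mean M Y t + b * prob {\<omega> \<in> space M. t < Y \<omega>}"
    and "integrable M (\<lambda>\<omega>. indicat_real {t<..} (Y \<omega>) * (a * Y \<omega> + b))"
proof -
  have [measurable]: "Y \<in> borel_measurable M" using assms by auto
  have eq: "(\<lambda>\<omega>. indicat_real {t<..} (Y \<omega>) * (a * Y \<omega> + b))
     = (\<lambda>\<omega>. a * (indicat_real {t<..} (Y \<omega>) * Y \<omega>) + b * indicat_real {t<..} (Y \<omega>))"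
    by (auto simp: algebra_simps)
  show "(\<integral>\<omega>. indicat_real {t<..} (Y \<omega>) * (a * Y \<omega> + b) \<partial>M)
      = a * tail_mean M Y t + b * prob {\<omega> \<in> space M. t < Y \<omega>}"
    unfolding eq
    by (subst Bochner_Integration.integral_add)
      (use assms in \<open>auto simp: tail_mean_def integral_exceed\<close>)
  show "integrable M (\<lambda>\<omega>. indicat_real {t<..} (Y \<omega>) * (a * Y \<omega> + b))"
    unfolding eq using assms
    by (intro Bochner_Integration.integrable_add integrable_mult_right integrable_tail
        integrable_exceed) auto
qed

lemma mean_excess_eq:
  assumes "integrable M Y"
  shows "(\<integral>\<omega>. max 0 (Y \<omega> - q) \<partial>M) = tail_mean M Y q - q * prob {\<omega> \<in> space M. q < Y \<omega>}"
proof -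
  have "(\<integral>\<omega>. max 0 (Y \<omega> - q) \<partial>M) = (\<integral>\<omega>. indicat_real {q<..} (Y \<omega>) * (1 * Y \<omega> + - q) \<partial>M)"
    by (intro Bochner_Integration.integral_cong) (auto simp: indicator_def)
  then show ?thesis by (simp only: integral_affine_tail[OF assms])
qed

lemma integrable_hinge [intro]:
  assumes "integrable M Y"
  shows "integrable M (\<lambda>\<omega>. max 0 (\<gamma> * Y \<omega> + 1 :: real))"
  using assms by (intro integrable_max) auto

text \<open>Restricting a nonnegative integrand to \<open>{Y > t}\<close> and dropping the positive part there
can only decrease it.  Equality holds for \<open>\<gamma> = -1/t\<close> with \<open>t < 0\<close>, because then the hinge is active
exactly on \<open>{Y > t}\<close>.  This pair of facts links minimizing the hinge mean with the zeros
of the tail mean.\<close>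
lemma hinge_mean_ge_tail:
  assumes "integrable M Y"
  shows "\<gamma> * tail_mean M Y t + prob {\<omega> \<in> space M. t < Y \<omega>} \<le> hinge_mean M Y \<gamma>"
proof -
  have "(\<integral>\<omega>. indicat_real {t<..} (Y \<omega>) * (\<gamma> * Y \<omega> + 1) \<partial>M) \<le> hinge_mean M Y \<gamma>"
    unfolding hinge_mean_def
    by (intro integral_mono integral_affine_tail integrable_hinge assms) (auto simp: indicator_def)
  then show ?thesis by (simp add: integral_affine_tail[OF assms])
qed

lemma hinge_mean_eq_tail:
  assumes "integrable M Y" "t < 0"
  shows "hinge_mean M Y (- 1 / t) = (- 1 / t) * tail_mean M Y t + prob {\<omega> \<in> space M. t < Y \<omega>}"
proof -
  have "hinge_mean M Y (- 1 / t) = (\<integral>\<omega>. indicat_real {t<..} (Y \<omega>) * ((- 1 / t) * Y \<omega> + 1) \<partial>M)"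
    unfolding hinge_mean_def
    by (intro Bochner_Integration.integral_cong)
      (use assms(2) in \<open>auto simp: indicator_def field_simps max_def\<close>)
  then show ?thesis by (simp only: integral_affine_tail[OF assms(1)] mult_1)
qed

lemma hinge_mean_0: "hinge_mean M Y 0 = 1"
  by (simp add: hinge_mean_def prob_space)

lemma hinge_mean_ge_affine:
  assumes "integrable M Y"
  shows "\<gamma> * expectation Y + 1 \<le> hinge_mean M Y \<gamma>"
proof -
  have "(\<integral>\<omega>. \<gamma> * Y \<omega> + 1 \<partial>M) \<le> hinge_mean M Y \<gamma>"
    unfolding hinge_mean_def using assms by (intro integral_mono integrable_hinge) auto
  then show ?thesis using assms by (simp add: prob_space)
qed

lemma hinge_mean_Lipschitz:
  assumes "integrable M Y"
  shows "\<bar>hinge_mean M Y \<gamma> - hinge_mean M Y \<gamma>'\<bar> \<le> (\<integral>\<omega>. \<bar>Y \<omega>\<bar> \<partial>M) * \<bar>\<gamma> - \<gamma>'\<bar>"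
proof -
  have "hinge_mean M Y \<gamma> - hinge_mean M Y \<gamma>'
      = (\<integral>\<omega>. max 0 (\<gamma> * Y \<omega> + 1) - max 0 (\<gamma>' * Y \<omega> + 1) \<partial>M)"
    unfolding hinge_mean_def using assms by (intro Bochner_Integration.integral_diff[symmetric]) auto
  also have "\<bar>\<dots>\<bar> \<le> (\<integral>\<omega>. \<bar>max 0 (\<gamma> * Y \<omega> + 1) - max 0 (\<gamma>' * Y \<omega> + 1)\<bar> \<partial>M)"
    by (rule integral_abs_bound)
  also have "\<dots> \<le> (\<integral>\<omega>. \<bar>Y \<omega>\<bar> * \<bar>\<gamma> - \<gamma>'\<bar> \<partial>M)"
  proof (intro integral_mono)
    fix \<omega>
    have "\<bar>max 0 (\<gamma> * Y \<omega> + 1) - max 0 (\<gamma>' * Y \<omega> + 1)\<bar> \<le> \<bar>(\<gamma> * Y \<omega> + 1) - (\<gamma>' * Y \<omega> + 1)\<bar>"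
      by (rule abs_max_0_diff_le)
    also have "\<dots> = \<bar>Y \<omega>\<bar> * \<bar>\<gamma> - \<gamma>'\<bar>" by (simp add: abs_mult[symmetric] algebra_simps)
    finally show "\<bar>max 0 (\<gamma> * Y \<omega> + 1) - max 0 (\<gamma>' * Y \<omega> + 1)\<bar> \<le> \<bar>Y \<omega>\<bar> * \<bar>\<gamma> - \<gamma>'\<bar>" .
  qed (use assms in auto)
  also have "\<dots> = (\<integral>\<omega>. \<bar>Y \<omega>\<bar> \<partial>M) * \<bar>\<gamma> - \<gamma>'\<bar>" by simp
  finally show ?thesis .
qed

lemma continuous_on_hinge_mean:
  assumes "integrable M Y"
  shows "continuous_on A (hinge_mean M Y)"
proof -
  have "(\<integral>\<omega>. \<bar>Y \<omega>\<bar> \<partial>M)-lipschitz_on A (hinge_mean M Y)"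
    using hinge_mean_Lipschitz[OF assms] by (intro lipschitz_onI) (auto simp: dist_real_def)
  then show ?thesis by (rule lipschitz_on_continuous_on)
qed

text \<open>Coercivity: a positive chance of exceeding a positive level forces linear growth, so
minimization over \<open>\<gamma> \<ge> 0\<close> takes place on an interval that depends only on \<open>\<epsilon>\<close>
and the probability of reaching \<open>\<epsilon>\<close>, and so on a common interval for a whole family of
random variables.\<close>
lemma hinge_mean_ge_linear:
  assumes "integrable M Y" "0 \<le> \<gamma>" "0 \<le> \<epsilon>"
  shows "\<gamma> * \<epsilon> * prob {\<omega> \<in> space M. \<epsilon> \<le> Y \<omega>} \<le> hinge_mean M Y \<gamma>"
proof -
  have [measurable]: "Y \<in> borel_measurable M" using assms by auto
  have "(\<integral>\<omega>. (\<gamma> * \<epsilon>) * indicat_real {\<omega> \<in> space M. \<epsilon> \<le> Y \<omega>} \<omega> \<partial>M) \<le> hinge_mean M Y \<gamma>"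
    unfolding hinge_mean_def
  proof (intro integral_mono integrable_hinge assms)
    fix \<omega>
    have "\<gamma> * \<epsilon> \<le> \<gamma> * Y \<omega>" if "\<epsilon> \<le> Y \<omega>" using that assms by (intro mult_left_mono)
    then show "(\<gamma> * \<epsilon>) * indicat_real {\<omega> \<in> space M. \<epsilon> \<le> Y \<omega>} \<omega> \<le> max 0 (\<gamma> * Y \<omega> + 1)"
      by (auto simp: indicator_def)
    show "integrable M (\<lambda>\<omega>. (\<gamma> * \<epsilon>) * indicat_real {\<omega> \<in> space M. \<epsilon> \<le> Y \<omega>} \<omega>)"
      by (intro integrable_mult_right integrable_real_indicator) (auto simp: emeasure_eq_measure)
  qed
  then show ?thesis by simp
qed

lemma hinge_mean_attains_min:
  assumes Y: "integrable M Y" and "0 < \<epsilon>" "0 < \<delta>" and \<delta>: "\<delta> \<le> prob {\<omega> \<in> space M. \<epsilon> \<le> Y \<omega>}"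
  obtains \<gamma> where "\<gamma> \<in> {0..1 / (\<epsilon> * \<delta>)}" "\<And>\<gamma>'. 0 \<le> \<gamma>' \<Longrightarrow> hinge_mean M Y \<gamma> \<le> hinge_mean M Y \<gamma>'"
proof -
  define C where "C = 1 / (\<epsilon> * \<delta>)"
  have C: "0 < C" using assms by (simp add: C_def)
  have "\<exists>x\<in>{0..C}. \<forall>y\<in>{0..C}. hinge_mean M Y x \<le> hinge_mean M Y y"
    using C by (intro continuous_attains_inf continuous_on_hinge_mean Y) auto
  then obtain \<gamma> where \<gamma>: "\<gamma> \<in> {0..C}" "\<And>y. y \<in> {0..C} \<Longrightarrow> hinge_mean M Y \<gamma> \<le> hinge_mean M Y y"
    by auto
  have "hinge_mean M Y \<gamma> \<le> hinge_mean M Y \<gamma>'" if "0 \<le> \<gamma>'" for \<gamma>'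
  proof (cases "\<gamma>' \<le> C")
    case False
    have "hinge_mean M Y \<gamma> \<le> 1" using \<gamma>(2)[of 0] C by (simp add: hinge_mean_0)
    also have "1 = C * \<epsilon> * \<delta>" using assms by (simp add: C_def)
    also have "\<dots> \<le> \<gamma>' * \<epsilon> * prob {\<omega> \<in> space M. \<epsilon> \<le> Y \<omega>}"
      using False assms that by (intro mult_mono) auto
    also have "\<dots> \<le> hinge_mean M Y \<gamma>'" using assms that by (intro hinge_mean_ge_linear) auto
    finally show ?thesis .
  qed (use that \<gamma> in auto)
  then show ?thesis using \<gamma>(1) that unfolding C_def by blast
qed

text \<open>The integrands converge except on the event \<open>Y = t\<close>, which is null.\<close>
lemma tendsto_tail_mean:
  assumes Y: "integrable M Y" and t: "prob {\<omega> \<in> space M. Y \<omega> = t} = 0" and s: "s \<longlonglongrightarrow> t"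
  shows "(\<lambda>n. tail_mean M Y (s n)) \<longlonglongrightarrow> tail_mean M Y t"
  unfolding tail_mean_def
proof (rule integral_dominated_convergence[where w="\<lambda>\<omega>. \<bar>Y \<omega>\<bar>"])
  have [measurable]: "Y \<in> borel_measurable M" using assms by auto
  show "(\<lambda>\<omega>. indicat_real {t<..} (Y \<omega>) * Y \<omega>) \<in> borel_measurable M" by measurable
  show "\<And>n. (\<lambda>\<omega>. indicat_real {s n<..} (Y \<omega>) * Y \<omega>) \<in> borel_measurable M" by measurable
  show "integrable M (\<lambda>\<omega>. \<bar>Y \<omega>\<bar>)" using Y by simp
  show "AE \<omega> in M. norm (indicat_real {s n<..} (Y \<omega>) * Y \<omega>) \<le> \<bar>Y \<omega>\<bar>" for n
    by (auto simp: indicator_def)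
  have "AE \<omega> in M. Y \<omega> \<noteq> t"
    using t by (subst AE_iff_measurable[OF _ refl]) (auto simp: emeasure_eq_measure)
  then show "AE \<omega> in M. (\<lambda>n. indicat_real {s n<..} (Y \<omega>) * Y \<omega>) \<longlonglongrightarrow> indicat_real {t<..} (Y \<omega>) * Y \<omega>"
  proof eventually_elim
    case (elim \<omega>)
    have "eventually (\<lambda>n. indicat_real {s n<..} (Y \<omega>) = indicat_real {t<..} (Y \<omega>)) sequentially"
    proof (cases "t < Y \<omega>")
      case True
      from order_tendstoD(2)[OF s this] show ?thesis
        by eventually_elim (use True in auto)
    next
      case False
      with elim have "Y \<omega> < t" by simp
      from order_tendstoD(1)[OF s this] show ?thesis
        by eventually_elim (use False in auto)
    qed
    then show ?case
      by (intro tendsto_eventually) (auto elim: eventually_mono)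
  qed
qed

text \<open>The first-order condition for a minimizer \<open>\<gamma> = -1/t\<close>.  The tail mean at \<open>s\<close> is a
subgradient of the hinge mean at \<open>-1/s\<close>; optimality of \<open>\<gamma>\<close> makes it nonpositive to the
left of \<open>t\<close> and nonnegative between \<open>t\<close> and 0, and there is no jump at \<open>t\<close>.\<close>
lemma tail_mean_eq_0_at_minimizer:
  assumes Y: "integrable M Y" and t: "t < 0" "prob {\<omega> \<in> space M. Y \<omega> = t} = 0"
    and min: "\<And>\<gamma>. 0 \<le> \<gamma> \<Longrightarrow> hinge_mean M Y (- 1 / t) \<le> hinge_mean M Y \<gamma>"
  shows "tail_mean M Y t = 0"
proof -
  have *: "(- 1 / t - - 1 / s) * tail_mean M Y s \<le> 0" if "s < 0" for s
    using hinge_mean_ge_tail[OF Y, of "- 1 / t" s] hinge_mean_eq_tail[OF Y that]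
      min[of "- 1 / s"] that by (simp add: algebra_simps)
  have lower: "0 \<le> tail_mean M Y s" if "t < s" "s < 0" for s
  proof -
    have "inverse s < inverse t" using that t by (simp add: inverse_less_iff_less_neg)
    then have "- 1 / t - - 1 / s < 0" by (simp add: divide_inverse)
    then show ?thesis using *[OF that(2)] by (simp add: mult_le_0_iff)
  qed
  have upper: "tail_mean M Y s \<le> 0" if "s < t" for s
  proof -
    have s: "s < 0" using that t by simp
    then have "inverse t < inverse s" using that t by (simp add: inverse_less_iff_less_neg)
    then have "- 1 / t - - 1 / s > 0" by (simp add: divide_inverse)
    then show ?thesis using *[OF s] by (simp add: mult_le_0_iff)
  qed
  have "(\<lambda>n. t * (1 + inverse (real (Suc n)))) \<longlonglongrightarrow> t * (1 + 0)"
    by (intro tendsto_intros LIMSEQ_inverse_real_of_nat)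
  then have "(\<lambda>n. tail_mean M Y (t * (1 + inverse (real (Suc n))))) \<longlonglongrightarrow> tail_mean M Y t"
    using tendsto_tail_mean[OF Y t(2)] by (simp only: add_0_right mult_1_right)
  then have "tail_mean M Y t \<le> 0"
  proof (rule LIMSEQ_le_const2, intro exI allI impI upper)
    show "t * (1 + inverse (real (Suc n))) < t" for n
      using mult_neg_pos[OF t(1), of "inverse (real (Suc n))"] by (simp only: distrib_left mult_1_right) simp
  qed
  moreover
  have "(\<lambda>n. t * (1 - inverse (real (Suc (Suc n))))) \<longlonglongrightarrow> t * (1 - 0)"
    by (intro tendsto_intros LIMSEQ_Suc[OF LIMSEQ_inverse_real_of_nat])
  then have "(\<lambda>n. tail_mean M Y (t * (1 - inverse (real (Suc (Suc n)))))) \<longlonglongrightarrow> tail_mean M Y t"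
    using tendsto_tail_mean[OF Y t(2)] by (simp only: diff_zero mult_1_right)
  then have "0 \<le> tail_mean M Y t"
  proof (rule LIMSEQ_le_const, intro exI allI impI lower)
    fix n
    have "inverse (real (Suc (Suc n))) < 1" by (simp add: inverse_less_1_iff)
    then show "t * (1 - inverse (real (Suc (Suc n)))) < 0" using t(1) by (intro mult_neg_pos) auto
    show "t < t * (1 - inverse (real (Suc (Suc n))))"
      using mult_neg_pos[OF t(1), of "inverse (real (Suc (Suc n)))"]
      by (simp only: right_diff_distrib mult_1_right) simp
  qed
  ultimately show ?thesis by simp
qed

section \<open>Quantiles and superquantiles\<close>

text \<open>The distribution function is right-continuous with limits 0 and 1, so for levels strictly
between 0 and 1 the set defining the quantile has a least element and the least-number
operator in its definition is meaningful.\<close>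
lemma quantile_properties:
  assumes [measurable]: "Y \<in> borel_measurable M" and \<alpha>: "0 < \<alpha>" "\<alpha> < 1"
  shows quantile_prob_ge: "\<alpha> \<le> prob {\<omega> \<in> space M. Y \<omega> \<le> quantile M Y \<alpha>}" (is ?A)
    and quantile_least: "\<And>z. \<alpha> \<le> prob {\<omega> \<in> space M. Y \<omega> \<le> z} \<Longrightarrow> quantile M Y \<alpha> \<le> z"
    and quantile_prob_less_le: "prob {\<omega> \<in> space M. Y \<omega> < quantile M Y \<alpha>} \<le> \<alpha>" (is ?C)
proof -
  define D where "D = distr M borel Y"
  interpret D: real_distribution D
    unfolding D_def by (rule real_distribution_distr) simp
  have cdf: "cdf D z = prob {\<omega> \<in> space M. Y \<omega> \<le> z}" for z
    unfolding D_def cdf_def2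
    by (subst measure_distr) (auto intro!: arg_cong[where f=prob])
  have cdf_less: "measure D {..<z} = prob {\<omega> \<in> space M. Y \<omega> < z}" for z
    unfolding D_def by (subst measure_distr) (auto intro!: arg_cong[where f=prob])
  define S where "S = {z. \<alpha> \<le> cdf D z}"
  have "eventually (\<lambda>z. \<alpha> < cdf D z) at_top"
    using order_tendstoD(1)[OF D.cdf_lim_at_top_prob \<alpha>(2)] .
  then have ne: "S \<noteq> {}" unfolding S_def
    by (auto simp: eventually_at_top_linorder intro: less_imp_le)
  obtain b where b: "\<And>z. z \<le> b \<Longrightarrow> cdf D z < \<alpha>"
    using order_tendstoD(2)[OF D.cdf_lim_at_bot \<alpha>(1)]
    by (auto simp: eventually_at_bot_linorder)
  have bdd: "bdd_below S"
  proof (rule bdd_belowI)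
    show "b \<le> z" if "z \<in> S" for z using that b[of z] by (cases "z \<le> b") (auto simp: S_def)
  qed
  have up: "z \<in> S" if less: "Inf S < z" for z
  proof -
    obtain y where "y \<in> S" "y < z" using cInf_lessD[OF ne less] by blast
    then show ?thesis using D.cdf_nondecreasing[of y z] by (auto simp: S_def)
  qed
  have "(cdf D \<longlongrightarrow> cdf D (Inf S)) (at_right (Inf S))"
    using D.cdf_is_right_cont by (simp add: continuous_within)
  moreover have "\<alpha> \<le> cdf D z" if "Inf S < z" for z
    using up[OF that] unfolding S_def by simp
  then have "eventually (\<lambda>z. \<alpha> \<le> cdf D z) (at_right (Inf S))"
    by (simp add: eventually_at_filter)
  ultimately have mem: "\<alpha> \<le> cdf D (Inf S)"
    by (intro tendsto_lowerbound) auto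
  have q: "quantile M Y \<alpha> = Inf S"
    unfolding quantile_def cdf[symmetric]
  proof (rule Least_equality)
    show "Inf S \<le> z" if "\<alpha> \<le> cdf D z" for z
      using that by (intro cInf_lower bdd) (simp add: S_def)
  qed (rule mem)
  show ?A using mem unfolding q cdf .
  show least: "quantile M Y \<alpha> \<le> z" if "\<alpha> \<le> prob {\<omega> \<in> space M. Y \<omega> \<le> z}" for z
    unfolding q using that by (intro cInf_lower bdd) (auto simp: S_def cdf)
  have "cdf D z \<le> \<alpha>" if "z < quantile M Y \<alpha>" for z
    using least[of z] that unfolding cdf by linarith
  then have "eventually (\<lambda>z. cdf D z \<le> \<alpha>) (at_left (quantile M Y \<alpha>))"
    by (simp add: eventually_at_filter)
  then have "measure D {..<quantile M Y \<alpha>} \<le> \<alpha>"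
    by (intro tendsto_upperbound[OF D.cdf_at_left]) auto
  then show ?C unfolding cdf_less .
qed

text \<open>If the superquantile vanishes, the quantile \<open>q\<close> is negative: the mean excess over \<open>q\<close>
is nonnegative, so \<open>q \<le> 0\<close>, and \<open>q = 0\<close> would make the mean excess over 0 vanish although
\<open>Y\<close> is positive with positive probability.
As \<open>q\<close> is no atom, \<open>P(Y > q) = 1 - \<alpha>\<close>, and the equation says that the tail mean at \<open>q\<close>
is zero.  Therefore \<open>1 - \<alpha>\<close> is the minimal hinge mean, whatever \<open>\<alpha>\<close> was.\<close>
lemma superquantile_interior_eq_0D:
  assumes Y: "integrable M Y" and atom: "\<And>t. t < 0 \<Longrightarrow> prob {\<omega> \<in> space M. Y \<omega> = t} = 0"
    and pos: "0 < prob {\<omega> \<in> space M. 0 < Y \<omega>}"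
    and \<alpha>: "0 < \<alpha>" "\<alpha> < 1" "superquantile_interior M Y \<alpha> = 0"
  obtains \<gamma> where "0 \<le> \<gamma>" "hinge_mean M Y \<gamma> = 1 - \<alpha>"
    "\<And>\<gamma>'. 0 \<le> \<gamma>' \<Longrightarrow> 1 - \<alpha> \<le> hinge_mean M Y \<gamma>'"
proof -
  have [measurable]: "Y \<in> borel_measurable M" using assms by auto
  define q where "q = quantile M Y \<alpha>"
  note qp = quantile_properties[OF _ \<alpha>(1,2), of Y, folded q_def]
  have S: "q + 1 / (1 - \<alpha>) * (\<integral>\<omega>. max 0 (Y \<omega> - q) \<partial>M) = 0"
    using \<alpha>(3) unfolding superquantile_interior_def q_def .
  have int: "integrable M (\<lambda>\<omega>. max 0 (Y \<omega> - q))"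
    using Y by (intro integrable_max) auto
  have "0 \<le> (\<integral>\<omega>. max 0 (Y \<omega> - q) \<partial>M)" by (intro integral_nonneg_AE) auto
  then have "0 \<le> 1 / (1 - \<alpha>) * (\<integral>\<omega>. max 0 (Y \<omega> - q) \<partial>M)" using \<alpha> by simp
  with S have "q \<le> 0" by linarith
  moreover have "q \<noteq> 0"
  proof
    assume "q = 0"
    then have "(\<integral>\<omega>. max 0 (Y \<omega> - q) \<partial>M) = 0" using S \<alpha> by simp
    then have "AE \<omega> in M. max 0 (Y \<omega> - q) = 0"
      by (subst (asm) integral_nonneg_eq_0_iff_AE[OF int]) auto
    then have "AE \<omega> in M. \<not> 0 < Y \<omega>" by eventually_elim (use \<open>q = 0\<close> in auto)
    then have "prob {\<omega> \<in> space M. 0 < Y \<omega>} = 0"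
      by (subst prob_eq_0) auto
    with pos show False by simp
  qed
  ultimately have q: "q < 0" by simp
  have "prob {\<omega> \<in> space M. Y \<omega> \<le> q} = prob ({\<omega> \<in> space M. Y \<omega> < q} \<union> {\<omega> \<in> space M. Y \<omega> = q})"
    by (intro arg_cong[where f=prob]) auto
  also have "\<dots> \<le> prob {\<omega> \<in> space M. Y \<omega> < q} + prob {\<omega> \<in> space M. Y \<omega> = q}"
    by (rule measure_Un_le) auto
  also have "\<dots> \<le> \<alpha>" using qp(3) atom[OF q] by simp
  finally have P: "prob {\<omega> \<in> space M. q < Y \<omega>} = 1 - \<alpha>"
    using qp(1) by (simp add: prob_le_eq_compl)
  then have "tail_mean M Y q = 0"
    using S \<alpha> unfolding mean_excess_eq[OF Y] P by (simp add: field_simps)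
  then show ?thesis
    using hinge_mean_eq_tail[OF Y q] hinge_mean_ge_tail[OF Y, of _ q] q P
    by (intro that[of "- 1 / q"]) (auto simp: divide_nonpos_neg)
qed

text \<open>The quantile at level \<open>P(Y \<le> t)\<close> may lie strictly below \<open>t\<close>, but then \<open>Y\<close> has no mass
in between, so the tail mean and tail probability at the quantile agree with those at \<open>t\<close>.\<close>
lemma superquantile_interior_eq_0I:
  assumes Y: "integrable M Y" and t: "t < 0" "tail_mean M Y t = 0"
    and P: "0 < prob {\<omega> \<in> space M. t < Y \<omega>}" "prob {\<omega> \<in> space M. t < Y \<omega>} < 1"
  shows "superquantile_interior M Y (1 - prob {\<omega> \<in> space M. t < Y \<omega>}) = 0"
proof -
  have [measurable]: "Y \<in> borel_measurable M" using assms by auto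
  define \<alpha> where "\<alpha> = 1 - prob {\<omega> \<in> space M. t < Y \<omega>}"
  have \<alpha>: "0 < \<alpha>" "\<alpha> < 1" using P by (auto simp: \<alpha>_def)
  define q where "q = quantile M Y \<alpha>"
  note qp = quantile_properties[OF _ \<alpha>(1,2), of Y, folded q_def]
  have qt: "q \<le> t" by (rule qp(2)) (auto simp: \<alpha>_def prob_le_eq_compl)
  have "prob {\<omega> \<in> space M. q < Y \<omega>} \<le> prob {\<omega> \<in> space M. t < Y \<omega>}"
    using qp(1) by (simp add: prob_le_eq_compl \<alpha>_def)
  moreover have "prob {\<omega> \<in> space M. q < Y \<omega> \<and> Y \<omega> \<le> t}
     = prob {\<omega> \<in> space M. q < Y \<omega>} - prob {\<omega> \<in> space M. t < Y \<omega>}"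
    using qt by (subst finite_measure_Diff[symmetric]) (auto intro!: arg_cong[where f=prob])
  ultimately have 0: "prob {\<omega> \<in> space M. q < Y \<omega> \<and> Y \<omega> \<le> t} = 0"
    and eqP: "prob {\<omega> \<in> space M. q < Y \<omega>} = prob {\<omega> \<in> space M. t < Y \<omega>}"
    using measure_nonneg[of M "{\<omega> \<in> space M. q < Y \<omega> \<and> Y \<omega> \<le> t}"] by linarith+
  have "AE \<omega> in M. \<not> (q < Y \<omega> \<and> Y \<omega> \<le> t)"
    using 0 by (subst (asm) prob_eq_0) auto
  then have "AE \<omega> in M. indicat_real {q<..} (Y \<omega>) * Y \<omega> = indicat_real {t<..} (Y \<omega>) * Y \<omega>"
    by eventually_elim (use qt in \<open>auto simp: indicator_def\<close>)
  then have "tail_mean M Y q = tail_mean M Y t"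
    unfolding tail_mean_def by (intro integral_cong_AE) auto
  then have "(\<integral>\<omega>. max 0 (Y \<omega> - q) \<partial>M) = - q * (1 - \<alpha>)"
    by (simp add: mean_excess_eq[OF Y] eqP t \<alpha>_def)
  then show ?thesis
    unfolding superquantile_interior_def \<alpha>_def[symmetric] q_def[symmetric] using \<alpha> by simp
qed

text \<open>The quantile of level \<open>\<alpha>\<close> does at least as well as any larger \<open>z\<close> in minimizing
\<open>z + E[max(0, Y - z)] / (1 - \<alpha>)\<close> (the Rockafellar--Uryasev formula), in particular as
well as the quantile of level \<open>\<beta>\<close>; afterwards the factor can be increased to
\<open>1 / (1 - \<beta>)\<close>.\<close>
lemma superquantile_interior_mono:
  assumes Y: "integrable M Y" and ab: "0 < \<alpha>" "\<alpha> \<le> \<beta>" "\<beta> < 1"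
  shows "superquantile_interior M Y \<alpha> \<le> superquantile_interior M Y \<beta>"
proof -
  have [measurable]: "Y \<in> borel_measurable M" using assms by auto
  define q where "q = quantile M Y \<alpha>"
  define r where "r = quantile M Y \<beta>"
  have \<alpha>: "0 < \<alpha>" "\<alpha> < 1" and \<beta>: "0 < \<beta>" "\<beta> < 1" using ab by auto
  note qp = quantile_properties[OF _ \<alpha>, of Y, folded q_def]
  note rp = quantile_properties[OF _ \<beta>, of Y, folded r_def]
  have qr: "q \<le> r" using qp(2)[of r] rp(1) ab by auto
  have int: "integrable M (\<lambda>\<omega>. max 0 (Y \<omega> - z))" for z
    using Y by (intro integrable_max) auto
  have "(\<integral>\<omega>. max 0 (Y \<omega> - q) \<partial>M)
      \<le> (\<integral>\<omega>. max 0 (Y \<omega> - r) + (r - q) * indicat_real {q<..} (Y \<omega>) \<partial>M)"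
    by (intro integral_mono Bochner_Integration.integrable_add integrable_mult_right integrable_exceed int)
      (use qr in \<open>auto simp: indicator_def max_def\<close>)
  also have "\<dots> = (\<integral>\<omega>. max 0 (Y \<omega> - r) \<partial>M) + (r - q) * prob {\<omega> \<in> space M. q < Y \<omega>}"
    by (subst Bochner_Integration.integral_add) (auto simp: integral_exceed int)
  also have "\<dots> \<le> (\<integral>\<omega>. max 0 (Y \<omega> - r) \<partial>M) + (r - q) * (1 - \<alpha>)"
    using qr qp(1) by (intro add_left_mono mult_left_mono) (auto simp: prob_le_eq_compl)
  finally have "1 / (1 - \<alpha>) * (\<integral>\<omega>. max 0 (Y \<omega> - q) \<partial>M)
      \<le> 1 / (1 - \<alpha>) * ((\<integral>\<omega>. max 0 (Y \<omega> - r) \<partial>M) + (r - q) * (1 - \<alpha>))"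
    using \<alpha> by (intro mult_left_mono) auto
  also have "\<dots> = 1 / (1 - \<alpha>) * (\<integral>\<omega>. max 0 (Y \<omega> - r) \<partial>M) + (r - q)"
    using \<alpha> by (simp add: field_simps)
  also have "1 / (1 - \<alpha>) * (\<integral>\<omega>. max 0 (Y \<omega> - r) \<partial>M) \<le> 1 / (1 - \<beta>) * (\<integral>\<omega>. max 0 (Y \<omega> - r) \<partial>M)"
    using ab by (intro mult_right_mono integral_nonneg_AE) (auto intro!: divide_left_mono)
  finally show ?thesis unfolding superquantile_interior_def q_def[symmetric] r_def[symmetric] by simp
qed

text \<open>The superquantile at level 1 is defined through a limit operator that means nothing unless
the limit exists.  Monotonicity supplies the limit as a supremum of extended reals, and
quantiles of levels close to 1 are at least \<open>\<epsilon>\<close>.  So level 1 is never a zero.\<close>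
lemma superquantile_1_pos:
  assumes Y: "integrable M Y" and "0 < \<epsilon>" "0 < prob {\<omega> \<in> space M. \<epsilon> \<le> Y \<omega>}"
  shows "0 < superquantile M Y 1"
proof -
  have [measurable]: "Y \<in> borel_measurable M" using assms by auto
  define S where "S = superquantile_interior M Y"
  define L where "L = (SUP \<beta>\<in>{0<..<1}. ereal (S \<beta>))"
  have lim: "((\<lambda>\<beta>. ereal (S \<beta>)) \<longlongrightarrow> L) (at_left 1)"
  proof (rule increasing_tendsto)
    have ev: "eventually (\<lambda>\<beta>::real. \<beta> \<in> {0<..<1}) (at_left 1)"
      by (rule eventually_at_leftI[of 0]) auto
    then show "eventually (\<lambda>\<beta>. ereal (S \<beta>) \<le> L) (at_left 1)"
      unfolding L_def by eventually_elim (rule SUP_upper)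
    fix y assume "y < L"
    then obtain \<alpha> where \<alpha>: "\<alpha> \<in> {0<..<1}" "y < ereal (S \<alpha>)"
      unfolding L_def less_SUP_iff by blast
    have "eventually (\<lambda>\<beta>. \<beta> \<in> {\<alpha><..<1}) (at_left 1)"
      by (rule eventually_at_leftI[of \<alpha>]) (use \<alpha> in auto)
    then show "eventually (\<lambda>\<beta>. y < ereal (S \<beta>)) (at_left 1)"
    proof eventually_elim
      case (elim \<beta>)
      have "S \<alpha> \<le> S \<beta>" unfolding S_def
        using elim \<alpha> by (intro superquantile_interior_mono Y) auto
      with \<alpha>(2) show ?case by (simp add: less_le_trans)
    qed
  qed
  \<comment> \<open>Any level strictly between \<open>1 - P(Y \<ge> \<epsilon>)\<close> and 1 serves.\<close>
  define \<beta> where "\<beta> = 1 - prob {\<omega> \<in> space M. \<epsilon> \<le> Y \<omega>} / 2"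
  have \<beta>: "\<beta> \<in> {0<..<1}" "1 - prob {\<omega> \<in> space M. \<epsilon> \<le> Y \<omega>} < \<beta>"
    using assms(3) prob_le_1[of "{\<omega> \<in> space M. \<epsilon> \<le> Y \<omega>}"]
    unfolding \<beta>_def greaterThanLessThan_iff by linarith+
  have "\<epsilon> \<le> quantile M Y \<beta>"
  proof (rule ccontr)
    assume "\<not> ?thesis"
    then have "prob {\<omega> \<in> space M. \<epsilon> \<le> Y \<omega>} \<le> prob {\<omega> \<in> space M. quantile M Y \<beta> < Y \<omega>}"
      by (intro finite_measure_mono) auto
    also have "\<dots> \<le> 1 - \<beta>"
      using quantile_prob_ge[of Y \<beta>] \<beta> by (simp add: prob_le_eq_compl)
    finally show False using \<beta>(2) by simp
  qed
  also have "\<dots> \<le> S \<beta>"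
    unfolding S_def superquantile_interior_def using \<beta> by (simp add: integral_nonneg_AE)
  finally have "ereal \<epsilon> \<le> ereal (S \<beta>)" by simp
  also have "\<dots> \<le> L" unfolding L_def by (rule SUP_upper) (rule \<beta>)
  finally have "ereal \<epsilon> \<le> L" .
  moreover have "0 < ereal \<epsilon>" using assms(2) by simp
  ultimately have "0 < L" by (rule less_le_trans[rotated])
  moreover have "superquantile M Y 1 = L"
    using tendsto_Lim[OF _ lim] by (simp add: superquantile_def S_def)
  ultimately show ?thesis by simp
qed

text \<open>Uniqueness of the zero level comes from the fact that each zero level is one minus the
minimal hinge mean.  For existence, the negative mean makes the hinge mean drop below its
value 1 at \<open>\<gamma> = 0\<close>, so a minimizer is positive and has the form \<open>-1/t\<close>.\<close>
lemma superquantile_zero_level_eq_min: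
  assumes Y: "integrable M Y" and atom: "\<And>t. t < 0 \<Longrightarrow> prob {\<omega> \<in> space M. Y \<omega> = t} = 0"
    and \<epsilon>: "0 < \<epsilon>" "0 < prob {\<omega> \<in> space M. \<epsilon> \<le> Y \<omega>}"
    and mean: "expectation Y < 0"
    and \<gamma>: "0 \<le> \<gamma>" "\<And>\<gamma>'. 0 \<le> \<gamma>' \<Longrightarrow> hinge_mean M Y \<gamma> \<le> hinge_mean M Y \<gamma>'"
  shows "1 - (THE \<alpha>. \<alpha> \<in> {0..1} \<and> superquantile M Y \<alpha> = 0) = hinge_mean M Y \<gamma>"
proof -
  have [measurable]: "Y \<in> borel_measurable M" using assms by auto
  have pos: "0 < prob {\<omega> \<in> space M. t < Y \<omega>}" if "t \<le> 0" for t
  proof -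
    have "prob {\<omega> \<in> space M. \<epsilon> \<le> Y \<omega>} \<le> prob {\<omega> \<in> space M. t < Y \<omega>}"
      using \<epsilon> that by (intro finite_measure_mono) auto
    with \<epsilon> show ?thesis by linarith
  qed
  have uniq: "\<alpha> = 1 - hinge_mean M Y \<gamma>" if "\<alpha> \<in> {0..1}" "superquantile M Y \<alpha> = 0" for \<alpha>
  proof -
    have "\<alpha> \<noteq> 0" using that mean by (auto simp: superquantile_def)
    moreover have "\<alpha> \<noteq> 1" using that superquantile_1_pos[OF Y \<epsilon>] by auto
    ultimately have \<alpha>: "0 < \<alpha>" "\<alpha> < 1" "superquantile_interior M Y \<alpha> = 0"
      using that by (auto simp: superquantile_def)
    from superquantile_interior_eq_0D[OF Y atom pos[OF order_refl] \<alpha>]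
    obtain \<gamma>' where "0 \<le> \<gamma>'" "hinge_mean M Y \<gamma>' = 1 - \<alpha>"
      "\<And>\<gamma>'. 0 \<le> \<gamma>' \<Longrightarrow> 1 - \<alpha> \<le> hinge_mean M Y \<gamma>'" by blast
    with \<gamma>(1) \<gamma>(2)[of \<gamma>'] show ?thesis by fastforce
  qed
  \<comment> \<open>The tail means tend to \<open>E[Y] < 0\<close> as the threshold goes to minus infinity.\<close>
  have "\<exists>s<0. hinge_mean M Y (- 1 / s) < 1"
  proof -
    have lim: "(\<lambda>n. tail_mean M Y (- real n)) \<longlonglongrightarrow> expectation Y"
      unfolding tail_mean_def
    proof (rule integral_dominated_convergence[where w="\<lambda>\<omega>. \<bar>Y \<omega>\<bar>"])
      show "AE \<omega> in M. (\<lambda>n. indicat_real {- real n<..} (Y \<omega>) * Y \<omega>) \<longlonglongrightarrow> Y \<omega>"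
      proof (rule AE_I2)
        fix \<omega>
        obtain N where N: "- Y \<omega> < real N" using reals_Archimedean2 by blast
        have "eventually (\<lambda>n. indicat_real {- real n<..} (Y \<omega>) * Y \<omega> = Y \<omega>) sequentially"
          using eventually_ge_at_top[of N] by eventually_elim (use N in \<open>auto simp: indicator_def\<close>)
        then show "(\<lambda>n. indicat_real {- real n<..} (Y \<omega>) * Y \<omega>) \<longlonglongrightarrow> Y \<omega>"
          by (rule tendsto_eventually)
      qed
    qed (use Y in \<open>auto simp: indicator_def\<close>)
    have "eventually (\<lambda>n. 0 < n \<and> tail_mean M Y (- real n) < 0) sequentially"
      using order_tendstoD(2)[OF lim mean] eventually_gt_at_top[of 0] by eventually_elim auto
    then obtain n where n: "0 < n" "tail_mean M Y (- real n) < 0"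
      by (auto dest: eventually_happens)
    then have "hinge_mean M Y (- 1 / - real n) < prob {\<omega> \<in> space M. - real n < Y \<omega>}"
      using hinge_mean_eq_tail[OF Y, of "- real n"] by (simp add: divide_neg_pos)
    also have "\<dots> \<le> 1" by (rule prob_le_1)
    finally show ?thesis using n(1) by (intro exI[of _ "- real n"]) auto
  qed
  then obtain s where s: "s < 0" "hinge_mean M Y (- 1 / s) < 1" by blast
  have lt1: "hinge_mean M Y \<gamma> < 1" using s \<gamma>(2)[of "- 1 / s"] by (auto simp: divide_nonpos_neg)
  then have "\<gamma> \<noteq> 0" by (auto simp: hinge_mean_0)
  \<comment> \<open>The threshold at which the hinge \<open>\<gamma> Y + 1\<close> switches on.\<close>
  define t where "t = - 1 / \<gamma>"
  have t: "t < 0" "- 1 / t = \<gamma>" using \<gamma>(1) \<open>\<gamma> \<noteq> 0\<close> by (auto simp: t_def field_simps)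
  have tail: "tail_mean M Y t = 0"
    using tail_mean_eq_0_at_minimizer[OF Y t(1) atom[OF t(1)]] \<gamma>(2) by (simp only: t(2))
  have P: "hinge_mean M Y \<gamma> = prob {\<omega> \<in> space M. t < Y \<omega>}"
    using hinge_mean_eq_tail[OF Y t(1)] tail t(2) by simp
  have Pt: "0 < prob {\<omega> \<in> space M. t < Y \<omega>}" "prob {\<omega> \<in> space M. t < Y \<omega>} < 1"
    using pos[of t] t lt1 P by auto
  have "superquantile M Y (1 - hinge_mean M Y \<gamma>) = 0"
    using superquantile_interior_eq_0I[OF Y t(1) tail Pt] Pt unfolding P superquantile_def by auto
  then have "(THE \<alpha>. \<alpha> \<in> {0..1} \<and> superquantile M Y \<alpha> = 0) = 1 - hinge_mean M Y \<gamma>"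
    using uniq Pt P by (intro the_equality) auto
  then show ?thesis by simp
qed

end

text \<open>When the mean is nonnegative, the affine minorant \<open>\<gamma> E[Y] + 1\<close> shows that the minimum is
attained at \<open>\<gamma> = 0\<close> and equals 1, in agreement with the last case of the definition.\<close>
lemma (in prob_space) buffered_failure_prob_eq_min_hinge_mean:
  fixes g :: "'m \<Rightarrow> 'n \<Rightarrow> real" and \<xi> :: "'a \<Rightarrow> 'm"
  defines "Y \<equiv> \<lambda>x \<omega>. g (\<xi> \<omega>) x"
  assumes Y: "integrable M (Y x)" and atom: "\<And>t. t < 0 \<Longrightarrow> prob {\<omega> \<in> space M. Y x \<omega> = t} = 0"
    and \<epsilon>: "0 < \<epsilon>" "0 < prob {\<omega> \<in> space M. \<epsilon> \<le> Y x \<omega>}"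
    and \<gamma>: "0 \<le> \<gamma>" "\<And>\<gamma>'. 0 \<le> \<gamma>' \<Longrightarrow> hinge_mean M (Y x) \<gamma> \<le> hinge_mean M (Y x) \<gamma>'"
  shows "buffered_failure_prob M \<xi> g x = hinge_mean M (Y x) \<gamma>"
proof -
  have [measurable]: "Y x \<in> borel_measurable M" using assms by auto
  have "prob {\<omega> \<in> space M. \<epsilon> \<le> Y x \<omega>} \<le> failure_prob M \<xi> g x"
    unfolding failure_prob_def Y_def
    using \<epsilon>(1) \<open>Y x \<in> borel_measurable M\<close>[unfolded Y_def] by (intro finite_measure_mono) auto
  then have p: "failure_prob M \<xi> g x \<noteq> 0" using \<epsilon> by linarith
  show ?thesis
  proof (cases "expectation (Y x) < 0")
    case True
    then show ?thesis
      using superquantile_zero_level_eq_min[OF Y atom \<epsilon> True \<gamma>] p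
      by (simp add: buffered_failure_prob_def Y_def)
  next
    case False
    have "1 \<le> \<gamma> * expectation (Y x) + 1" using False \<gamma>(1) by simp
    also have "\<dots> \<le> hinge_mean M (Y x) \<gamma>" by (rule hinge_mean_ge_affine[OF Y])
    finally have "hinge_mean M (Y x) \<gamma> = 1" using \<gamma>(2)[of 0] by (simp add: hinge_mean_0)
    then show ?thesis using p False by (simp add: buffered_failure_prob_def Y_def)
  qed
qed

section \<open>Stability of minimizers\<close>

text \<open>Outside any ball around the unique minimizer, \<open>f\<close> is bounded away from its minimum by
compactness.\<close>
lemma unique_minimizer_tendsto:
  fixes f :: "'a::metric_space \<Rightarrow> real"
  assumes K: "compact K" "continuous_on K f"
    and a: "\<And>z. z \<in> K \<Longrightarrow> f z \<le> f a \<Longrightarrow> z = a"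
    and y: "\<And>k. y k \<in> K" "(\<lambda>k. f (y k)) \<longlonglongrightarrow> f a"
  shows "y \<longlonglongrightarrow> a"
proof (rule tendstoI)
  fix e :: real assume "0 < e"
  show "eventually (\<lambda>k. dist (y k) a < e) sequentially"
  proof (cases "K - ball a e = {}")
    case True
    then have "y k \<in> ball a e" for k using y(1)[of k] by blast
    then show ?thesis by (simp add: dist_commute)
  next
    case False
    have "\<exists>z\<in>K - ball a e. \<forall>x\<in>K - ball a e. f z \<le> f x"
      using K False by (intro continuous_attains_inf compact_diff) (auto intro: continuous_on_subset)
    then obtain z where z: "z \<in> K - ball a e" "\<And>x. x \<in> K - ball a e \<Longrightarrow> f z \<le> f x" by blast
    have "f a < f z" using a[of z] z(1) \<open>0 < e\<close> by (cases "f z \<le> f a") auto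
    from order_tendstoD(2)[OF y(2) this] show ?thesis
    proof eventually_elim
      case (elim k)
      then have "y k \<in> ball a e" using z(2)[of "y k"] y(1)[of k] by (cases "y k \<in> ball a e") auto
      then show ?case by (simp add: dist_commute)
    qed
  qed
qed

lemma eventually_max_0_diff_eq:
  fixes v w :: "nat \<Rightarrow> real"
  assumes "v \<longlonglongrightarrow> c" "w \<longlonglongrightarrow> c" "c \<noteq> 0"
  shows "eventually (\<lambda>k. max 0 (v k) - max 0 (w k) = (if c \<le> 0 then 0 else v k - w k)) sequentially"
proof (cases "c < 0")
  case True
  from order_tendstoD(2)[OF assms(1) True] order_tendstoD(2)[OF assms(2) True]
  show ?thesis by eventually_elim (use True in auto)
next
  case False
  with assms have c: "0 < c" by simp
  from order_tendstoD(1)[OF assms(1) c] order_tendstoD(1)[OF assms(2) c]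
  show ?thesis by eventually_elim (use c in auto)
qed

section \<open>Gradients\<close>

text \<open>A sequential form of the directional derivative.  It determines the gradient as a limit of
countably many measurable functions, and it also yields uniqueness and norm bounds.\<close>
lemma GDERIV_directional_limit:
  assumes "GDERIV f x :> G"
  shows "(\<lambda>n. (f (x + inverse (real (Suc n)) *\<^sub>R v) - f x) * real (Suc n)) \<longlonglongrightarrow> v \<bullet> G"
proof -
  have "((\<lambda>t::real. f (x + t *\<^sub>R v)) has_derivative (\<lambda>h. (h *\<^sub>R v) \<bullet> G)) (at 0)"
    by (rule has_derivative_compose[where f="\<lambda>t. x + t *\<^sub>R v" and g=f and g'="\<lambda>h. h \<bullet> G"])
      (use assms in \<open>auto simp: gderiv_def intro!: derivative_eq_intros\<close>)
  then have "((\<lambda>t. f (x + t *\<^sub>R v)) has_field_derivative v \<bullet> G) (at 0)"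
    by (simp add: has_field_derivative_def mult_commute_abs)
  then have "((\<lambda>h. (f (x + h *\<^sub>R v) - f x) / h) \<longlongrightarrow> v \<bullet> G) (at 0)"
    by (simp add: DERIV_def)
  then have "((\<lambda>h. (f (x + h *\<^sub>R v) - f x) / h) \<circ> (\<lambda>n. inverse (real (Suc n)))) \<longlonglongrightarrow> v \<bullet> G"
    unfolding tendsto_at_iff_sequentially
    using LIMSEQ_inverse_real_of_nat by auto
  then show ?thesis by (simp add: o_def divide_inverse)
qed

lemma GDERIV_unique:
  assumes "GDERIV f x :> D" "GDERIV f x :> E"
  shows "D = E"
proof -
  have "v \<bullet> D = v \<bullet> E" for v
    by (rule LIMSEQ_unique[OF GDERIV_directional_limit[OF assms(1), of v] GDERIV_directional_limit[OF assms(2), of v]])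
  then show ?thesis using vector_eq_ldot[of D E] by blast
qed

lemma gradient_eqI: "GDERIV f x :> D \<Longrightarrow> gradient f x = D"
  unfolding gradient_def by (blast intro: GDERIV_unique)

lemma norm_GDERIV_le_Lipschitz:
  assumes G: "GDERIV f x :> G" and x: "x \<in> interior X" and K: "0 \<le> K"
    and lip: "\<And>y. y \<in> X \<Longrightarrow> \<bar>f y - f x\<bar> \<le> K * norm (y - x)"
  shows "norm G \<le> K"
proof -
  let ?y = "\<lambda>n. x + inverse (real (Suc n)) *\<^sub>R G"
  have "?y \<longlonglongrightarrow> x + 0 *\<^sub>R G"
    by (intro tendsto_intros LIMSEQ_inverse_real_of_nat)
  then have "eventually (\<lambda>n. ?y n \<in> interior X) sequentially"
    using x by (intro topological_tendstoD) auto
  then have "eventually (\<lambda>n. (f (?y n) - f x) * real (Suc n) \<le> K * norm G) sequentially"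
  proof eventually_elim
    case (elim n)
    then have "f (?y n) - f x \<le> K * norm (?y n - x)"
      using lip[of "?y n"] interior_subset by (auto simp: abs_le_iff)
    then have "(f (?y n) - f x) * real (Suc n) \<le> K * norm (?y n - x) * real (Suc n)"
      by (rule mult_right_mono) simp
    also have "\<dots> = K * norm G" by simp
    finally show ?case .
  qed
  then have "G \<bullet> G \<le> K * norm G"
    by (intro tendsto_upperbound[OF GDERIV_directional_limit[OF G]]) auto
  then have "norm G * norm G \<le> K * norm G" by (simp add: dot_square_norm power2_eq_square)
  then show ?thesis using K by (cases "G = 0") auto
qed

text \<open>The measure need not be complete, so it is not enough to know the gradient almost
everywhere.  The set of \<open>\<omega>\<close> where \<open>f \<omega>\<close> is differentiable is itself measurable: the only
candidate \<open>D\<close> for the gradient is a sum of limits along coordinate directions, and by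
continuity the estimate that defines differentiability need only be tested on a countable
dense set of increments.  Off this set the gradient is one fixed vector.\<close>
lemma borel_measurable_gradient:
  fixes f :: "'w \<Rightarrow> 'b::euclidean_space \<Rightarrow> real"
  assumes [measurable]: "\<And>x. (\<lambda>\<omega>. f \<omega> x) \<in> borel_measurable M"
    and x: "x \<in> interior X" and cont: "\<And>\<omega>. continuous_on X (f \<omega>)"
  shows "(\<lambda>\<omega>. gradient (f \<omega>) x) \<in> borel_measurable M"
proof -
  define D where "D \<omega> = (\<Sum>b\<in>Basis.
      lim (\<lambda>n. (f \<omega> (x + inverse (real (Suc n)) *\<^sub>R b) - f \<omega> x) * real (Suc n)) *\<^sub>R b)" for \<omega>
  have D_meas [measurable]: "D \<in> borel_measurable M"
    unfolding D_def by measurable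
  have D: "D \<omega> = G" if "GDERIV (f \<omega>) x :> G" for \<omega> G
    unfolding D_def limI[OF GDERIV_directional_limit[OF that]]
    by (simp add: inner_commute[of _ G] euclidean_representation)
  obtain Q :: "'b set" where Q: "countable Q" "\<And>U. open U \<Longrightarrow> U \<noteq> {} \<Longrightarrow> \<exists>d\<in>Q. d \<in> U"
    using countable_dense_setE by blast
  define q where "q = from_nat_into Q"
  have "Q \<noteq> {}" using Q(2)[of UNIV] by auto
  then have q: "\<exists>k. q k \<in> U" if "open U" "U \<noteq> {}" for U
    using Q(2)[OF that] range_from_nat_into[OF _ Q(1)] unfolding q_def by (metis imageE)
  obtain r where r: "0 < r" "ball x r \<subseteq> X" using x by (auto simp: mem_interior)
  define P where "P \<omega> \<longleftrightarrow> (\<forall>n. \<exists>m. \<forall>k. norm (q k) < inverse (real (Suc m)) \<longrightarrow>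
      \<bar>f \<omega> (x + q k) - f \<omega> x - q k \<bullet> D \<omega>\<bar> \<le> inverse (real (Suc n)) * norm (q k))" for \<omega>
  have P_meas [measurable]: "Measurable.pred M P"
    unfolding P_def by measurable
  have P1: "P \<omega>" if "GDERIV (f \<omega>) x :> G" for \<omega> G
    unfolding P_def
  proof
    fix n
    have "0 < inverse (real (Suc n))" by simp
    moreover have "GDERIV (f \<omega>) x :> D \<omega>" using D[OF that] that by simp
    ultimately obtain d where d: "0 < d" "\<And>y. norm (y - x) < d \<Longrightarrow>
        \<bar>f \<omega> y - f \<omega> x - (y - x) \<bullet> D \<omega>\<bar> \<le> inverse (real (Suc n)) * norm (y - x)"
      unfolding gderiv_def has_derivative_at_alt real_norm_def by blast
    obtain m where m: "inverse (real (Suc m)) < d" using reals_Archimedean[OF d(1)] by blast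
    show "\<exists>m. \<forall>k. norm (q k) < inverse (real (Suc m)) \<longrightarrow>
      \<bar>f \<omega> (x + q k) - f \<omega> x - q k \<bullet> D \<omega>\<bar> \<le> inverse (real (Suc n)) * norm (q k)"
      using d(2)[of "x + q _"] m by (intro exI[of _ m]) force
  qed
  have P2: "GDERIV (f \<omega>) x :> D \<omega>" if holds: "P \<omega>" for \<omega>
    unfolding gderiv_def has_derivative_at_alt real_norm_def
  proof (intro conjI allI impI bounded_linear_inner_left)
    fix e :: real assume "0 < e"
    then obtain n where n: "inverse (real (Suc n)) < e" using reals_Archimedean by blast
    obtain m where m: "\<And>k. norm (q k) < inverse (real (Suc m)) \<Longrightarrow>
      \<bar>f \<omega> (x + q k) - f \<omega> x - q k \<bullet> D \<omega>\<bar> \<le> inverse (real (Suc n)) * norm (q k)"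
      using holds unfolding P_def by blast
    define s where "s = min r (inverse (real (Suc m)))"
    define \<psi> where "\<psi> h = e * norm h - \<bar>f \<omega> (x + h) - f \<omega> x - h \<bullet> D \<omega>\<bar>" for h
    have "continuous_on (ball 0 s) (\<lambda>h. f \<omega> (x + h))"
      by (rule continuous_on_compose2[OF cont[of \<omega>]])
        (use r(2) in \<open>auto intro!: continuous_intros simp: s_def dist_norm\<close>)
    then have "continuous_on (ball 0 s) \<psi>"
      unfolding \<psi>_def by (intro continuous_intros)
    \<comment> \<open>Were \<open>\<psi>\<close> negative anywhere, it would be so on an open set and hence at some \<open>q k\<close>.\<close>
    then have op: "open (ball 0 s \<inter> \<psi> -` {..<0})"
      by (intro continuous_open_preimage) auto
    have "ball 0 s \<inter> \<psi> -` {..<0} = {}"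
    proof (rule ccontr)
      assume "\<not> ?thesis"
      then obtain k where k: "norm (q k) < s" "\<psi> (q k) < 0" using q[OF op] by auto
      have "\<bar>f \<omega> (x + q k) - f \<omega> x - q k \<bullet> D \<omega>\<bar> \<le> inverse (real (Suc n)) * norm (q k)"
        using k(1) by (intro m) (simp add: s_def)
      also have "\<dots> \<le> e * norm (q k)" using n by (intro mult_right_mono) auto
      finally show False using k(2) by (simp add: \<psi>_def)
    qed
    then have *: "0 \<le> \<psi> h" if "norm h < s" for h using that by (cases "0 \<le> \<psi> h") auto
    show "\<exists>d>0. \<forall>y. norm (y - x) < d \<longrightarrow> \<bar>f \<omega> y - f \<omega> x - (y - x) \<bullet> D \<omega>\<bar> \<le> e * norm (y - x)"
      using *[of "_ - x"] r(1) by (intro exI[of _ s]) (auto simp: \<psi>_def s_def)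
  qed
  have "gradient (f \<omega>) x = (if P \<omega> then D \<omega> else (THE d. False))" for \<omega>
  proof (cases "P \<omega>")
    case True
    then show ?thesis using gradient_eqI[OF P2] by simp
  next
    case False
    then have "(\<lambda>d. GDERIV (f \<omega>) x :> d) = (\<lambda>d. False)" using P1 by blast
    then show ?thesis using False by (simp add: gradient_def)
  qed
  then show ?thesis by simp
qed

section \<open>Differentiating the hinge mean\<close>

text \<open>Away from the kink \<open>\<gamma> f x0 + 1 = 0\<close>, the hinge is eventually inactive or eventually
active at both points, so the positive parts disappear from the difference quotient.  The
Lipschitz bound dominates the quotients.  The multiplier \<open>c\<close> is the same at \<open>u k\<close> and
at \<open>x0\<close> but may vary with \<open>k\<close>; this is what makes the lower estimate of the envelope
argument work, where only \<open>c k \<longlonglongrightarrow> \<gamma>\<close> is known and no rate.\<close>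
lemma (in prob_space) hinge_mean_difference_quotient:
  fixes f :: "'b::euclidean_space \<Rightarrow> 'a \<Rightarrow> real" and G :: "'a \<Rightarrow> 'b"
  assumes int: "\<And>x. x \<in> X \<Longrightarrow> integrable M (f x)" and x0: "x0 \<in> X"
    and \<kappa>: "integrable M \<kappa>" and lip: "\<And>x \<omega>. x \<in> X \<Longrightarrow> \<bar>f x \<omega> - f x0 \<omega>\<bar> \<le> \<kappa> \<omega> * norm (x - x0)"
    and G [measurable]: "G \<in> borel_measurable M" and G_le: "AE \<omega> in M. norm (G \<omega>) \<le> \<kappa> \<omega>"
    and deriv: "AE \<omega> in M. GDERIV (\<lambda>x. f x \<omega>) x0 :> G \<omega>"
    and kink: "AE \<omega> in M. \<gamma> * f x0 \<omega> + 1 \<noteq> 0"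
  defines "F \<equiv> \<lambda>\<omega>. if \<gamma> * f x0 \<omega> + 1 \<le> 0 then 0 else \<gamma> *\<^sub>R G \<omega>"
  shows "integrable M F"
    and "\<And>u c. (\<And>k. u k \<in> X - {x0}) \<Longrightarrow> u \<longlonglongrightarrow> x0 \<Longrightarrow> c \<longlonglongrightarrow> \<gamma> \<Longrightarrow>
      (\<lambda>k. (hinge_mean M (f (u k)) (c k) - hinge_mean M (f x0) (c k) - (u k - x0) \<bullet> integral\<^sup>L M F)
            / norm (u k - x0)) \<longlonglongrightarrow> 0"
proof -
  have [measurable]: "f x0 \<in> borel_measurable M" using int[OF x0] by auto
  have [measurable]: "F \<in> borel_measurable M" unfolding F_def by measurable
  have F_le: "AE \<omega> in M. norm (F \<omega>) \<le> \<bar>\<gamma>\<bar> * \<kappa> \<omega>"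
    using G_le
  proof eventually_elim
    case (elim \<omega>)
    have "0 \<le> \<kappa> \<omega>" using elim norm_ge_zero order_trans by blast
    then show ?case using elim by (auto simp: F_def intro!: mult_left_mono)
  qed
  show F: "integrable M F"
  proof (rule Bochner_Integration.integrable_bound)
    show "integrable M (\<lambda>\<omega>. \<bar>\<gamma>\<bar> * \<kappa> \<omega>)" using \<kappa> by simp
    show "AE \<omega> in M. norm (F \<omega>) \<le> norm (\<bar>\<gamma>\<bar> * \<kappa> \<omega>)"
      using F_le by eventually_elim auto
  qed measurable
  fix u :: "nat \<Rightarrow> 'b" and c :: "nat \<Rightarrow> real"
  assume u: "\<And>k. u k \<in> X - {x0}" "u \<longlonglongrightarrow> x0" and c: "c \<longlonglongrightarrow> \<gamma>"
  obtain B where B: "\<And>k. \<bar>c k\<bar> \<le> B"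
    using convergent_imp_Bseq[OF convergentI[OF c]] by (auto simp: Bseq_def)
  have u_pos: "0 < norm (u k - x0)" for k using u(1)[of k] by auto
  define s where "s k \<omega> = (max 0 (c k * f (u k) \<omega> + 1) - max 0 (c k * f x0 \<omega> + 1) - (u k - x0) \<bullet> F \<omega>)
      / norm (u k - x0)" for k \<omega>
  have int': "integrable M (f (u k))" for k using int u(1) by auto
  have s_int: "integrable M (s k)" for k
    unfolding s_def using int' int[OF x0] F
    by (intro Bochner_Integration.integrable_diff integrable_divide_zero integrable_inner_right impI integrable_hinge)
  have eq: "integral\<^sup>L M (s k) = (hinge_mean M (f (u k)) (c k) - hinge_mean M (f x0) (c k)
      - (u k - x0) \<bullet> integral\<^sup>L M F) / norm (u k - x0)" for k
    unfolding s_def hinge_mean_def using int' int[OF x0] F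
    by (simp add: integrable_hinge)
  have "(\<lambda>k. integral\<^sup>L M (s k)) \<longlonglongrightarrow> integral\<^sup>L M (\<lambda>\<omega>. 0)"
  proof (rule integral_dominated_convergence[where w="\<lambda>\<omega>. (B + \<bar>\<gamma>\<bar>) * \<kappa> \<omega>"])
    show "integrable M (\<lambda>\<omega>. (B + \<bar>\<gamma>\<bar>) * \<kappa> \<omega>)" using \<kappa> by simp
    show "AE \<omega> in M. norm (s k \<omega>) \<le> (B + \<bar>\<gamma>\<bar>) * \<kappa> \<omega>" for k
      using F_le
    proof eventually_elim
      case (elim \<omega>)
      have "\<bar>max 0 (c k * f (u k) \<omega> + 1) - max 0 (c k * f x0 \<omega> + 1)\<bar>
          \<le> \<bar>(c k * f (u k) \<omega> + 1) - (c k * f x0 \<omega> + 1)\<bar>"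
        by (rule abs_max_0_diff_le)
      also have "\<dots> = \<bar>c k\<bar> * \<bar>f (u k) \<omega> - f x0 \<omega>\<bar>" by (simp add: abs_mult[symmetric] algebra_simps)
      also have "\<dots> \<le> B * (\<kappa> \<omega> * norm (u k - x0))"
        using u(1)[of k] B[of k] by (intro mult_mono lip) auto
      finally have 1: "\<bar>max 0 (c k * f (u k) \<omega> + 1) - max 0 (c k * f x0 \<omega> + 1)\<bar>
          \<le> B * \<kappa> \<omega> * norm (u k - x0)" by (simp add: mult.assoc)
      have "\<bar>(u k - x0) \<bullet> F \<omega>\<bar> \<le> norm (u k - x0) * norm (F \<omega>)" by (rule Cauchy_Schwarz_ineq2)
      also have "\<dots> \<le> norm (u k - x0) * (\<bar>\<gamma>\<bar> * \<kappa> \<omega>)" using elim by (intro mult_left_mono) auto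
      also have "\<dots> = \<bar>\<gamma>\<bar> * \<kappa> \<omega> * norm (u k - x0)" by simp
      finally have "\<bar>max 0 (c k * f (u k) \<omega> + 1) - max 0 (c k * f x0 \<omega> + 1) - (u k - x0) \<bullet> F \<omega>\<bar>
          \<le> (B + \<bar>\<gamma>\<bar>) * \<kappa> \<omega> * norm (u k - x0)"
        using 1 unfolding distrib_right by linarith
      then show ?case using u_pos[of k] by (simp add: s_def field_simps)
    qed
    show "AE \<omega> in M. (\<lambda>k. s k \<omega>) \<longlonglongrightarrow> 0"
      using deriv kink
    proof eventually_elim
      case (elim \<omega>)
      let ?n = "\<lambda>k. norm (u k - x0)"
      have n0: "?n \<longlonglongrightarrow> 0" using u(2) by (simp add: LIM_zero_iff tendsto_norm_zero_iff)
      have "((\<lambda>y. norm (f y \<omega> - f x0 \<omega> - (y - x0) \<bullet> G \<omega>) / norm (y - x0)) \<longlongrightarrow> 0) (at x0)"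
        using elim(1) unfolding gderiv_def has_derivative_iff_norm by simp
      then have q: "(\<lambda>k. norm (f (u k) \<omega> - f x0 \<omega> - (u k - x0) \<bullet> G \<omega>) / ?n k) \<longlonglongrightarrow> 0"
        unfolding tendsto_at_iff_sequentially o_def using u by simp
      have fu: "(\<lambda>k. f (u k) \<omega>) \<longlonglongrightarrow> f x0 \<omega>"
      proof (rule LIM_zero_cancel, rule Lim_null_comparison[where g="\<lambda>k. \<kappa> \<omega> * ?n k"])
        have "\<bar>f (u k) \<omega> - f x0 \<omega>\<bar> \<le> \<kappa> \<omega> * ?n k" for k using lip u(1)[of k] by blast
        then show "eventually (\<lambda>k. norm (f (u k) \<omega> - f x0 \<omega>) \<le> \<kappa> \<omega> * ?n k) sequentially" by simp
      qed (rule tendsto_mult_right_zero[OF n0])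
      have "eventually (\<lambda>k. max 0 (c k * f (u k) \<omega> + 1) - max 0 (c k * f x0 \<omega> + 1)
          = (if \<gamma> * f x0 \<omega> + 1 \<le> 0 then 0 else (c k * f (u k) \<omega> + 1) - (c k * f x0 \<omega> + 1))) sequentially"
        using elim(2) by (intro eventually_max_0_diff_eq tendsto_intros c fu)
      \<comment> \<open>Adding and subtracting \<open>c k * ((u k - x0) \<bullet> G \<omega>)\<close> in the active case leaves a bounded
        multiple of the remainder of the derivative and a term that vanishes with \<open>c k - \<gamma>\<close>.\<close>
      then have ev: "eventually (\<lambda>k. s k \<omega> = (if \<gamma> * f x0 \<omega> + 1 \<le> 0 then 0 else
          c k * ((f (u k) \<omega> - f x0 \<omega> - (u k - x0) \<bullet> G \<omega>) / ?n k)
          + (c k - \<gamma>) * (((u k - x0) \<bullet> G \<omega>) / ?n k))) sequentially"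
        by eventually_elim (use u_pos in \<open>auto simp: s_def F_def field_simps\<close>)
      have "(\<lambda>k. c k * ((f (u k) \<omega> - f x0 \<omega> - (u k - x0) \<bullet> G \<omega>) / ?n k)) \<longlonglongrightarrow> \<gamma> * 0"
        by (intro tendsto_mult c, rule tendsto_norm_zero_cancel) (use q in simp)
      moreover have "(\<lambda>k. (c k - \<gamma>) * (((u k - x0) \<bullet> G \<omega>) / ?n k)) \<longlonglongrightarrow> 0"
      proof (rule Lim_null_comparison[where g="\<lambda>k. \<bar>c k - \<gamma>\<bar> * norm (G \<omega>)"])
        show "(\<lambda>k. \<bar>c k - \<gamma>\<bar> * norm (G \<omega>)) \<longlonglongrightarrow> 0"
          using c by (intro tendsto_mult_left_zero) (simp add: LIM_zero_iff tendsto_rabs_zero_iff)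
        have "\<bar>(u k - x0) \<bullet> G \<omega>\<bar> / ?n k \<le> norm (G \<omega>)" for k
          using Cauchy_Schwarz_ineq2[of "u k - x0" "G \<omega>"] u_pos[of k] by (simp add: field_simps)
        then show "eventually (\<lambda>k. norm ((c k - \<gamma>) * (((u k - x0) \<bullet> G \<omega>) / ?n k))
            \<le> \<bar>c k - \<gamma>\<bar> * norm (G \<omega>)) sequentially"
          by (intro always_eventually allI) (simp only: real_norm_def abs_mult abs_divide abs_norm_cancel mult_left_mono abs_ge_zero)
      qed
      ultimately have "(\<lambda>k. c k * ((f (u k) \<omega> - f x0 \<omega> - (u k - x0) \<bullet> G \<omega>) / ?n k)
          + (c k - \<gamma>) * (((u k - x0) \<bullet> G \<omega>) / ?n k)) \<longlonglongrightarrow> \<gamma> * 0 + 0"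
        by (rule tendsto_add)
      then have "(\<lambda>k. if \<gamma> * f x0 \<omega> + 1 \<le> 0 then 0 else
          c k * ((f (u k) \<omega> - f x0 \<omega> - (u k - x0) \<bullet> G \<omega>) / ?n k)
          + (c k - \<gamma>) * (((u k - x0) \<bullet> G \<omega>) / ?n k)) \<longlonglongrightarrow> 0"
        by (cases "\<gamma> * f x0 \<omega> + 1 \<le> 0") (simp_all only: if_True if_False mult_zero_right add_0_left tendsto_const)
      with ev show ?case by (subst tendsto_cong)
    qed
    show "s k \<in> borel_measurable M" for k using s_int by auto
  qed simp
  then show "(\<lambda>k. (hinge_mean M (f (u k)) (c k) - hinge_mean M (f x0) (c k) - (u k - x0) \<bullet> integral\<^sup>L M F)
            / norm (u k - x0)) \<longlonglongrightarrow> 0"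
    by (simp add: eq)
qed

lemma (in prob_space) hinge_mean_param_Lipschitz:
  assumes Y: "integrable M Y" "integrable M Z" and \<kappa>: "integrable M \<kappa>"
    and le: "\<And>\<omega>. \<bar>Y \<omega> - Z \<omega>\<bar> \<le> \<kappa> \<omega> * r"
  shows "\<bar>hinge_mean M Y \<gamma> - hinge_mean M Z \<gamma>\<bar> \<le> \<bar>\<gamma>\<bar> * (expectation \<kappa> * r)"
proof -
  have "hinge_mean M Y \<gamma> - hinge_mean M Z \<gamma> = (\<integral>\<omega>. max 0 (\<gamma> * Y \<omega> + 1) - max 0 (\<gamma> * Z \<omega> + 1) \<partial>M)"
    unfolding hinge_mean_def using Y by (intro Bochner_Integration.integral_diff[symmetric]) auto
  also have "\<bar>\<dots>\<bar> \<le> (\<integral>\<omega>. \<bar>max 0 (\<gamma> * Y \<omega> + 1) - max 0 (\<gamma> * Z \<omega> + 1)\<bar> \<partial>M)"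
    by (rule integral_abs_bound)
  also have "\<dots> \<le> (\<integral>\<omega>. \<bar>\<gamma>\<bar> * (\<kappa> \<omega> * r) \<partial>M)"
  proof (intro integral_mono)
    fix \<omega>
    have "\<bar>max 0 (\<gamma> * Y \<omega> + 1) - max 0 (\<gamma> * Z \<omega> + 1)\<bar> \<le> \<bar>(\<gamma> * Y \<omega> + 1) - (\<gamma> * Z \<omega> + 1)\<bar>"
      by (rule abs_max_0_diff_le)
    also have "\<dots> = \<bar>\<gamma>\<bar> * \<bar>Y \<omega> - Z \<omega>\<bar>" by (simp add: abs_mult[symmetric] algebra_simps)
    also have "\<dots> \<le> \<bar>\<gamma>\<bar> * (\<kappa> \<omega> * r)" using le by (intro mult_left_mono) auto
    finally show "\<bar>max 0 (\<gamma> * Y \<omega> + 1) - max 0 (\<gamma> * Z \<omega> + 1)\<bar> \<le> \<bar>\<gamma>\<bar> * (\<kappa> \<omega> * r)" .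
  qed (use Y \<kappa> in auto)
  also have "\<dots> = \<bar>\<gamma>\<bar> * (expectation \<kappa> * r)" using \<kappa> by simp
  finally show ?thesis .
qed

section \<open>The envelope argument\<close>

theorem theorem3p1:
  fixes M :: "'w measure"
    and \<xi> :: "'w \<Rightarrow> real ^ 'm"
    and g :: "real ^ 'm \<Rightarrow> real ^ 'n \<Rightarrow> real"
    and xhat :: "real ^ 'n"
    and X :: "(real ^ 'n) set"
    and \<gamma>hat :: real
  assumes "prob_space M"
    and "\<xi> \<in> borel_measurable M"
    and "\<And>x. integrable M (\<lambda>\<omega>. g (\<xi> \<omega>) x)"
    and "xhat \<in> interior X"
    and a: "\<And>x. x \<in> X \<Longrightarrow>
        \<exists>\<Xi>. measure M {\<omega> \<in> space M. \<xi> \<omega> \<in> \<Xi>} = 1 \<and> (\<forall>z\<in>\<Xi>. smooth_at (g z) x)"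
    and b: "\<exists>\<epsilon>>0. \<exists>\<delta>\<in>{0<..1}. \<forall>x\<in>X. measure M {\<omega> \<in> space M. g (\<xi> \<omega>) x \<ge> \<epsilon>} \<ge> \<delta>"
    and c: "\<exists>h \<in> borel_measurable borel. (\<forall>z. h z \<ge> 0) \<and> integrable M (\<lambda>\<omega>. h (\<xi> \<omega>)) \<and>
        (\<forall>z. \<forall>x\<in>X. \<bar>g z x\<bar> \<le> h z)"
    and d: "\<exists>\<kappa> \<in> borel_measurable borel. (\<forall>z. \<kappa> z \<ge> 0) \<and> integrable M (\<lambda>\<omega>. \<kappa> (\<xi> \<omega>)) \<and>
        (\<forall>x\<in>X. \<forall>x'\<in>X. \<forall>z. \<bar>g z x - g z x'\<bar> \<le> \<kappa> z * norm (x - x'))"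
    and e: "\<And>\<gamma> x. \<gamma> > 0 \<Longrightarrow> x \<in> X \<Longrightarrow> measure M {\<omega> \<in> space M. - \<gamma> * g (\<xi> \<omega>) x = 1} = 0"
    and f: "{\<gamma>. is_arg_min (\<lambda>\<gamma>. integral\<^sup>L M (\<lambda>\<omega>. max 0 (\<gamma> * g (\<xi> \<omega>) xhat + 1)))
                 (\<lambda>\<gamma>. \<gamma> \<ge> 0) \<gamma>} = {\<gamma>hat}"
  shows "integrable M (\<lambda>\<omega>. grad_integrand g (\<xi> \<omega>) xhat \<gamma>hat) \<and>
    GDERIV (buffered_failure_prob M \<xi> g) xhat :>
      integral\<^sup>L M (\<lambda>\<omega>. grad_integrand g (\<xi> \<omega>) xhat \<gamma>hat)"
proof -
  interpret prob_space M by fact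
  have int: "integrable M (\<lambda>\<omega>. g (\<xi> \<omega>) x)" for x by fact
  have [measurable]: "(\<lambda>\<omega>. g (\<xi> \<omega>) x) \<in> borel_measurable M" for x using int by auto
  have xhat: "xhat \<in> interior X" by fact
  then have xX: "xhat \<in> X" using interior_subset by auto
  define \<phi> where "\<phi> x \<gamma> = hinge_mean M (\<lambda>\<omega>. g (\<xi> \<omega>) x) \<gamma>" for x \<gamma>
  define p where "p = buffered_failure_prob M \<xi> g"
  obtain \<epsilon> \<delta> where \<epsilon>: "0 < \<epsilon>" "0 < \<delta>"
    "\<And>x. x \<in> X \<Longrightarrow> \<delta> \<le> prob {\<omega> \<in> space M. \<epsilon> \<le> g (\<xi> \<omega>) x}"
    using b by auto
  obtain \<kappa>' where "integrable M (\<lambda>\<omega>. \<kappa>' (\<xi> \<omega>))"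
    "\<And>x x' z. x \<in> X \<Longrightarrow> x' \<in> X \<Longrightarrow> \<bar>g z x - g z x'\<bar> \<le> \<kappa>' z * norm (x - x')" "\<And>z. 0 \<le> \<kappa>' z"
    using d by blast
  moreover define \<kappa> where "\<kappa> = (\<lambda>\<omega>. \<kappa>' (\<xi> \<omega>))"
  ultimately have \<kappa>: "integrable M \<kappa>" "\<And>\<omega>. 0 \<le> \<kappa> \<omega>"
    "\<And>x x' \<omega>. x \<in> X \<Longrightarrow> x' \<in> X \<Longrightarrow> \<bar>g (\<xi> \<omega>) x - g (\<xi> \<omega>) x'\<bar> \<le> \<kappa> \<omega> * norm (x - x')"
    by auto
  define C where "C = 1 / (\<epsilon> * \<delta>)"
  have "\<exists>\<gamma>. \<gamma> \<in> {0..C} \<and> (\<forall>\<gamma>'\<ge>0. \<phi> x \<gamma> \<le> \<phi> x \<gamma>')" if "x \<in> X" for x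
    using hinge_mean_attains_min[OF int \<epsilon>(1,2) \<epsilon>(3)[OF that]] unfolding \<phi>_def C_def by metis
  then obtain \<Gamma> where \<Gamma>: "\<And>x. x \<in> X \<Longrightarrow> \<Gamma> x \<in> {0..C}"
    "\<And>x \<gamma>. x \<in> X \<Longrightarrow> 0 \<le> \<gamma> \<Longrightarrow> \<phi> x (\<Gamma> x) \<le> \<phi> x \<gamma>"
    by metis
  have p_eq: "p x = \<phi> x (\<Gamma> x)" if "x \<in> X" for x
    unfolding p_def \<phi>_def
  proof (rule buffered_failure_prob_eq_min_hinge_mean[where g=g and \<xi>=\<xi> and x=x, OF int _ \<epsilon>(1)])
    fix t :: real assume t: "t < 0"
    then have "(- (- 1 / t) * y = 1) = (y = t)" for y by (auto simp: field_simps)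
    moreover have "0 < - 1 / t" using t by (simp add: divide_neg_neg)
    ultimately show "prob {\<omega> \<in> space M. g (\<xi> \<omega>) x = t} = 0"
      using e[of "- 1 / t" x] \<open>x \<in> X\<close> by simp
  next
    show "0 < prob {\<omega> \<in> space M. \<epsilon> \<le> g (\<xi> \<omega>) x}"
      using \<epsilon>(2) \<epsilon>(3)[OF \<open>x \<in> X\<close>] by linarith
    show "0 \<le> \<Gamma> x" using \<Gamma>(1)[OF \<open>x \<in> X\<close>] by simp
  qed (rule \<Gamma>(2)[OF \<open>x \<in> X\<close>, unfolded \<phi>_def])
  have min_iff: "\<gamma> = \<gamma>hat \<longleftrightarrow> 0 \<le> \<gamma> \<and> (\<forall>\<gamma>'\<ge>0. \<phi> xhat \<gamma> \<le> \<phi> xhat \<gamma>')" for \<gamma>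
  proof -
    have "\<gamma> = \<gamma>hat \<longleftrightarrow> \<gamma> \<in> {\<gamma>. is_arg_min (\<phi> xhat) (\<lambda>\<gamma>. \<gamma> \<ge> 0) \<gamma>}"
      using f unfolding \<phi>_def hinge_mean_def by simp
    then show ?thesis unfolding is_arg_min_linorder mem_Collect_eq .
  qed
  have \<Gamma>_hat: "\<Gamma> xhat = \<gamma>hat" using min_iff[of "\<Gamma> xhat"] \<Gamma>[OF xX] by auto
  have \<gamma>hat: "0 \<le> \<gamma>hat" "\<And>\<gamma>. 0 \<le> \<gamma> \<Longrightarrow> \<phi> xhat \<gamma>hat \<le> \<phi> xhat \<gamma>" using min_iff[of \<gamma>hat] by auto
  define G where "G \<omega> = gradient (g (\<xi> \<omega>)) xhat" for \<omega>
  have G_meas: "G \<in> borel_measurable M"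
    unfolding G_def
  proof (rule borel_measurable_gradient[OF _ xhat])
    fix \<omega>
    \<comment> \<open>The Lipschitz bound holds for every \<open>\<omega>\<close>, not just almost surely.\<close>
    show "continuous_on X (g (\<xi> \<omega>))"
      by (rule lipschitz_on_continuous_on[of "\<kappa> \<omega>"], rule lipschitz_onI)
        (use \<kappa> in \<open>auto simp: dist_norm\<close>)
  qed measurable
  have G: "AE \<omega> in M. GDERIV (g (\<xi> \<omega>)) xhat :> G \<omega>"
  proof -
    obtain \<Xi> where \<Xi>: "prob {\<omega> \<in> space M. \<xi> \<omega> \<in> \<Xi>} = 1" "\<And>z. z \<in> \<Xi> \<Longrightarrow> smooth_at (g z) xhat"
      using a[OF xX] by blast
    show ?thesis
      using AE_prob_1[OF \<Xi>(1)]
    proof eventually_elim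
      case (elim \<omega>)
      then obtain D where "GDERIV (g (\<xi> \<omega>)) xhat :> D"
        using \<Xi>(2)[of "\<xi> \<omega>"] by (auto simp: smooth_at_def)
      then show ?case unfolding G_def by (simp add: gradient_eqI)
    qed
  qed
  have G_le: "AE \<omega> in M. norm (G \<omega>) \<le> \<kappa> \<omega>"
    using G by eventually_elim (rule norm_GDERIV_le_Lipschitz[OF _ xhat \<kappa>(2)], use \<kappa>(3) xX in auto)
  \<comment> \<open>For \<open>\<gamma>hat = 0\<close> the expression is 1; otherwise the no-atom hypothesis applies.\<close>
  have kink: "AE \<omega> in M. \<gamma>hat * g (\<xi> \<omega>) xhat + 1 \<noteq> 0"
  proof (cases "\<gamma>hat = 0")
    case False
    then have "prob {\<omega> \<in> space M. - \<gamma>hat * g (\<xi> \<omega>) xhat = 1} = 0" using \<gamma>hat(1) xX by (intro e) auto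
    then have "AE \<omega> in M. \<not> - \<gamma>hat * g (\<xi> \<omega>) xhat = 1" by (subst (asm) prob_eq_0) auto
    then show ?thesis by eventually_elim auto
  qed simp
  define F where "F \<omega> = grad_integrand g (\<xi> \<omega>) xhat \<gamma>hat" for \<omega>
  have F_eq: "F = (\<lambda>\<omega>. if \<gamma>hat * g (\<xi> \<omega>) xhat + 1 \<le> 0 then 0 else \<gamma>hat *\<^sub>R G \<omega>)"
    by (auto simp: F_def grad_integrand_def G_def)
  note quot = hinge_mean_difference_quotient[where f="\<lambda>x \<omega>. g (\<xi> \<omega>) x" and X=X and \<gamma>=\<gamma>hat,
      OF int xX \<kappa>(1) \<kappa>(3)[OF _ xX] G_meas G_le G kink, folded F_eq \<phi>_def]
  define Q where "Q x = (p x - p xhat - (x - xhat) \<bullet> integral\<^sup>L M F) / norm (x - xhat)" for x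
  have "(Q \<longlongrightarrow> 0) (at xhat within X)"
    unfolding tendsto_at_iff_sequentially o_def
  proof (intro allI impI)
    fix u assume u: "\<forall>k. u k \<in> X - {xhat}" "u \<longlonglongrightarrow> xhat"
    then have uX: "u k \<in> X" for k by auto
    have n0: "(\<lambda>k. norm (u k - xhat)) \<longlonglongrightarrow> 0" using u(2) by (simp add: LIM_zero_iff tendsto_norm_zero_iff)
    have \<phi>_lip: "\<bar>\<phi> (u k) \<gamma> - \<phi> xhat \<gamma>\<bar> \<le> C * (expectation \<kappa> * norm (u k - xhat))"
      if "\<gamma> \<in> {0..C}" for k \<gamma>
    proof -
      have "\<bar>\<phi> (u k) \<gamma> - \<phi> xhat \<gamma>\<bar> \<le> \<bar>\<gamma>\<bar> * (expectation \<kappa> * norm (u k - xhat))"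
        unfolding \<phi>_def using \<kappa>(3)[OF uX xX] by (intro hinge_mean_param_Lipschitz int \<kappa>(1)) auto
      also have "\<dots> \<le> C * (expectation \<kappa> * norm (u k - xhat))"
        using that \<kappa>(2) by (intro mult_right_mono mult_nonneg_nonneg integral_nonneg_AE) auto
      finally show ?thesis .
    qed
    have \<gamma>hatC: "\<gamma>hat \<in> {0..C}" using \<Gamma>(1)[OF xX] \<Gamma>_hat by simp
    have \<Gamma>_lim: "(\<lambda>k. \<Gamma> (u k)) \<longlonglongrightarrow> \<gamma>hat"
    proof (rule unique_minimizer_tendsto[where K="{0..C}" and f="\<phi> xhat"])
      show "compact {0..C}" by simp
      show "continuous_on {0..C} (\<phi> xhat)" unfolding \<phi>_def by (rule continuous_on_hinge_mean[OF int])
      show "z = \<gamma>hat" if "z \<in> {0..C}" "\<phi> xhat z \<le> \<phi> xhat \<gamma>hat" for z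
        using that \<gamma>hat(2) min_iff[of z] by (auto intro: order_trans)
      show "\<Gamma> (u k) \<in> {0..C}" for k using \<Gamma>(1)[OF uX] .
      show "(\<lambda>k. \<phi> xhat (\<Gamma> (u k))) \<longlonglongrightarrow> \<phi> xhat \<gamma>hat"
      proof (rule tendsto_sandwich[OF always_eventually always_eventually])
        show "\<forall>k. \<phi> xhat \<gamma>hat \<le> \<phi> xhat (\<Gamma> (u k))" using \<gamma>hat(2) \<Gamma>(1)[OF uX] by auto
        \<comment> \<open>Move from \<open>xhat\<close> to \<open>u k\<close>, use optimality of \<open>\<Gamma> (u k)\<close> there, and move back.\<close>
        show "\<forall>k. \<phi> xhat (\<Gamma> (u k)) \<le> \<phi> xhat \<gamma>hat + 2 * (C * (expectation \<kappa> * norm (u k - xhat)))"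
        proof
          fix k
          show "\<phi> xhat (\<Gamma> (u k)) \<le> \<phi> xhat \<gamma>hat + 2 * (C * (expectation \<kappa> * norm (u k - xhat)))"
            using \<phi>_lip[OF \<Gamma>(1)[OF uX[of k]], of k] \<phi>_lip[OF \<gamma>hatC, of k] \<Gamma>(2)[OF uX[of k] \<gamma>hat(1)]
            by linarith
        qed
        have "(\<lambda>k. \<phi> xhat \<gamma>hat + 2 * (C * (expectation \<kappa> * norm (u k - xhat))))
            \<longlonglongrightarrow> \<phi> xhat \<gamma>hat + 2 * (C * (expectation \<kappa> * 0))"
          by (intro tendsto_intros n0)
        then show "(\<lambda>k. \<phi> xhat \<gamma>hat + 2 * (C * (expectation \<kappa> * norm (u k - xhat))))
            \<longlonglongrightarrow> \<phi> xhat \<gamma>hat" by simp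
      qed simp
    qed
    show "(\<lambda>k. Q (u k)) \<longlonglongrightarrow> 0"
    proof (rule tendsto_sandwich[OF always_eventually always_eventually])
      show "(\<lambda>k. (\<phi> (u k) (\<Gamma> (u k)) - \<phi> xhat (\<Gamma> (u k)) - (u k - xhat) \<bullet> integral\<^sup>L M F)
            / norm (u k - xhat)) \<longlonglongrightarrow> 0"
        using u \<Gamma>_lim by (intro quot) auto
      show "(\<lambda>k. (\<phi> (u k) \<gamma>hat - \<phi> xhat \<gamma>hat - (u k - xhat) \<bullet> integral\<^sup>L M F)
            / norm (u k - xhat)) \<longlonglongrightarrow> 0"
        using u by (intro quot) auto
      show "\<forall>k. (\<phi> (u k) (\<Gamma> (u k)) - \<phi> xhat (\<Gamma> (u k)) - (u k - xhat) \<bullet> integral\<^sup>L M F)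
            / norm (u k - xhat) \<le> Q (u k)"
        using \<gamma>hat(2) \<Gamma>(1)[OF uX] by (auto simp: Q_def p_eq uX xX \<Gamma>_hat intro!: divide_right_mono)
      show "\<forall>k. Q (u k) \<le> (\<phi> (u k) \<gamma>hat - \<phi> xhat \<gamma>hat - (u k - xhat) \<bullet> integral\<^sup>L M F)
            / norm (u k - xhat)"
        using \<Gamma>(2)[OF uX \<gamma>hat(1)] by (auto simp: Q_def p_eq uX xX \<Gamma>_hat intro!: divide_right_mono)
    qed
  qed
  then have "((\<lambda>x. norm (Q x)) \<longlongrightarrow> 0) (at xhat)"
    unfolding at_within_interior[OF xhat] by (rule tendsto_norm_zero)
  then have "GDERIV p xhat :> integral\<^sup>L M F"
    unfolding gderiv_def has_derivative_iff_norm
    by (simp add: Q_def bounded_linear_inner_left)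
  with quot(1) show ?thesis unfolding p_def F_def by blast
qed

end
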